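(* Let $G$ be a connected finite simple graph on $n\geq 2$ vertices. Then: (i) $pc_{1,2}(G)=n-1$ if and only if $G$ is isomorphic to the star $S_n$ or to a double star $T(n_1,n_2)$ for some integers $n_1,n_2\geq 1$. (ii) $pc_{1,2}(G)=n-2$ if and only if $G$ is isomorphic to one of the following graphs: a cycle $C_3$, $C_4$ or $C_5$; one of the eight graphs in the list $\mathcal{L}$ (defined in the context); or a graph $T^1(n_1,n_2)$ for some integers $n_1,n_2\geq 1$.
   Context: All graphs are finite, undirected and simple. An edge-coloring is an arbitrary map from the edge set to a set of colors (adjacent edges may receive the same color). In an edge-colored graph, a path $P$ is a distance $2$-proper path if no two edges of $P$ of the same color appear with fewer than $2$ edges in between on $P$; equivalently, any two distinct edges of $P$ that are consecutive on $P$ or separated by exactly one edge of $P$ have different colors. For a connected graph $G$, the $(1,2)$-proper connection number $pc_{1,2}(G)$ is the minimum number of colors in an edge-coloring of $G$ such that every two distinct vertices of $G$ are joined by a distance $2$-proper path in $G$. $S_n$ is the star on $n$ vertices ($S_n=K_{1,n-1}$) and $C_n$ is the cycle on $n$ vertices. For $n_1,n_2\geq 1$, the double star $T(n_1,n_2)$ is the tree on $n_1+n_2+2$ vertices consisting of two adjacent center vertices $u,v$, with $n_1$ leaves attached to $u$ and $n_2$ leaves attached to $v$ (so the centers have degrees $n_1+1$ and $n_2+1$). $T^1(n_1,n_2)$ denotes a tree obtained from $T(n_1,n_2)$ by replacing one pendent edge with a path $P_3$ on three vertices, i.e. by subdividing one pendent edge once (equivalently, attaching a new leaf to one of the leaves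 of $T(n_1,n_2)$). The list $\mathcal{L}$ consists of the following eight graphs: (1) on vertices $a,b,c,d$: edges $ab,bc,ca,ad$ (a triangle with one pendent edge); (2) on vertices $a,b,c,d$: the graph $K_4$ minus one edge; (3) on vertices $a,b,c,d,e$: edges $ab,bc,cd,da,ae$ (a $4$-cycle with one pendent edge); (4) on vertices $a,b,c,d,e$: edges $ab,bc,ca,ad,ae$ (a triangle with two pendent edges at the same vertex); (5) on vertices $a,b,c,d,e$: edges $ab,bc,ca,ad,be$ (a triangle with pendent edges at two different vertices); (6) on vertices $a,b,c,d,e$: edges $ab,bc,ca,ad,de$ (a triangle with a pendent path of length $2$ attached at one vertex); (7) on vertices $a,b,c,d,e$: edges $ab,bc,bd,cd,ce,de$ ($K_4$ minus an edge, with a pendent edge attached at a vertex of degree $2$); (8) on vertices $u,v,a,b,c,d$: edges $ua,ub,ab,uv,vc,vd$ (the double star $T(2,2)$ with an edge added between the two leaves at one center). *)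

theory Defs
  imports Main
begin

record 'a ugraph =
  verts :: "'a set"
  edges :: "'a set set"

definition simple_graph :: "'a ugraph \<Rightarrow> bool" where
  "simple_graph G \<longleftrightarrow> finite (verts G) \<and>
     (\<forall>e\<in>edges G. \<exists>x\<in>verts G. \<exists>y\<in>verts G. x \<noteq> y \<and> e = {x, y})"

definition graph_iso :: "'a ugraph \<Rightarrow> 'b ugraph \<Rightarrow> bool" where
  "graph_iso G H \<longleftrightarrow> (\<exists>f. bij_betw f (verts G) (verts H) \<and>
     (\<forall>x\<in>verts G. \<forall>y\<in>verts G. {x, y} \<in> edges G \<longleftrightarrow> {f x, f y} \<in> edges H))"

definition is_path :: "'a ugraph \<Rightarrow> 'a list \<Rightarrow> bool" where
  "is_path G p \<longleftrightarrow> p \<noteq> [] \<and> distinct p \<and> set p \<subseteq> verts G \<and>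
     (\<forall>i. Suc i < length p \<longrightarrow> {p ! i, p ! Suc i} \<in> edges G)"

definition path_edges :: "'a list \<Rightarrow> 'a set list" where
  "path_edges p = map (\<lambda>i. {p ! i, p ! Suc i}) [0..<length p - 1]"

definition connected_graph :: "'a ugraph \<Rightarrow> bool" where
  "connected_graph G \<longleftrightarrow> verts G \<noteq> {} \<and>
     (\<forall>x\<in>verts G. \<forall>y\<in>verts G. \<exists>p. is_path G p \<and> hd p = x \<and> last p = y)"

text \<open>The edges at positions \<open>i < j\<close> of a path have \<open>j - i - 1\<close> edges of the path in between.\<close>

definition dist2_proper :: "('a set \<Rightarrow> nat) \<Rightarrow> 'a list \<Rightarrow> bool" where
  "dist2_proper c p \<longleftrightarrow>
     (\<forall>i j. i < j \<and> j < length (path_edges p) \<and> j - i - 1 < 2 \<longrightarrow>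
        c (path_edges p ! i) \<noteq> c (path_edges p ! j))"

definition pc12_coloring :: "'a ugraph \<Rightarrow> ('a set \<Rightarrow> nat) \<Rightarrow> bool" where
  "pc12_coloring G c \<longleftrightarrow> (\<forall>x\<in>verts G. \<forall>y\<in>verts G. x \<noteq> y \<longrightarrow>
     (\<exists>p. is_path G p \<and> hd p = x \<and> last p = y \<and> dist2_proper c p))"

text \<open>Natural numbers suffice as colors because the edge set is finite. For a connected
  simple graph the minimum exists: any coloring that is injective on the edges qualifies.\<close>

definition pc12 :: "'a ugraph \<Rightarrow> nat" where
  "pc12 G = (LEAST k. \<exists>c. pc12_coloring G c \<and> card (c ` edges G) = k)"

definition star_graph :: "nat \<Rightarrow> nat ugraph" where
  "star_graph n = \<lparr>verts = {..<n}, edges = {{0, i} | i. 1 \<le> i \<and> i < n}\<rparr>"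

text \<open>A cycle in the usual sense only for \<open>n \<ge> 3\<close>.\<close>

definition cycle_graph :: "nat \<Rightarrow> nat ugraph" where
  "cycle_graph n = \<lparr>verts = {..<n}, edges = {{i, (i + 1) mod n} | i. i < n}\<rparr>"

text \<open>The centers are \<open>0\<close> and \<open>1\<close>; the leaves at \<open>0\<close> are \<open>2, \<dots>, n1 + 1\<close> and the
  leaves at \<open>1\<close> are \<open>n1 + 2, \<dots>, n1 + n2 + 1\<close>.\<close>

definition double_star :: "nat \<Rightarrow> nat \<Rightarrow> nat ugraph" where
  "double_star n1 n2 = \<lparr>verts = {..<n1 + n2 + 2},
     edges = {{0, 1}} \<union> {{0, i} | i. 2 \<le> i \<and> i < n1 + 2}
                      \<union> {{1, i} | i. n1 + 2 \<le> i \<and> i < n1 + n2 + 2}\<rparr>"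

definition pendent_edge :: "'a ugraph \<Rightarrow> 'a set \<Rightarrow> bool" where
  "pendent_edge G e \<longleftrightarrow> e \<in> edges G \<and> (\<exists>x\<in>e. card {e' \<in> edges G. x \<in> e'} = 1)"

definition subdivide_edge :: "'a ugraph \<Rightarrow> 'a set \<Rightarrow> 'a \<Rightarrow> 'a ugraph" where
  "subdivide_edge G e w = \<lparr>verts = insert w (verts G),
     edges = (edges G - {e}) \<union> {{x, w} | x. x \<in> e}\<rparr>"

text \<open>The graphs \<open>T\<^sup>1(n1, n2)\<close>, one for each choice of the pendent edge that is subdivided;
  the subdividing vertex is the first natural number that is not a vertex of the double star.\<close>

definition double_star1 :: "nat \<Rightarrow> nat \<Rightarrow> nat ugraph set" where
  "double_star1 n1 n2 =
     {subdivide_edge (double_star n1 n2) e (n1 + n2 + 2) | e. pendent_edge (double_star n1 n2) e}"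

definition graph_list_L :: "nat ugraph list" where
  "graph_list_L =
    (let a = 0; b = 1; c = 2; d = 3; e = 4; u = 4; v = 5 in
     [\<lparr>verts = {a, b, c, d}, edges = {{a, b}, {b, c}, {c, a}, {a, d}}\<rparr>,
      \<lparr>verts = {a, b, c, d}, edges = {{a, b}, {b, c}, {c, a}, {b, d}, {c, d}}\<rparr>,
      \<lparr>verts = {a, b, c, d, e}, edges = {{a, b}, {b, c}, {c, d}, {d, a}, {a, e}}\<rparr>,
      \<lparr>verts = {a, b, c, d, e}, edges = {{a, b}, {b, c}, {c, a}, {a, d}, {a, e}}\<rparr>,
      \<lparr>verts = {a, b, c, d, e}, edges = {{a, b}, {b, c}, {c, a}, {a, d}, {b, e}}\<rparr>,
      \<lparr>verts = {a, b, c, d, e}, edges = {{a, b}, {b, c}, {c, a}, {a, d}, {d, e}}\<rparr>,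
      \<lparr>verts = {a, b, c, d, e}, edges = {{a, b}, {b, c}, {b, d}, {c, d}, {c, e}, {d, e}}\<rparr>,
      \<lparr>verts = {u, v, a, b, c, d}, edges = {{u, a}, {u, b}, {a, b}, {u, v}, {v, c}, {v, d}}\<rparr>])"

end

theory Submission
  imports Defs
begin

text \<open>If a connected subgraph on \<open>k\<close> vertices can be colored with \<open>k - 3\<close> colors, then growing it by
  pendant edges with fresh colors shows \<open>pc\<^sub>1\<^sub>,\<^sub>2(G) \<le> n - 3\<close>. Hence only graphs that avoid every such
  \<^emph>\<open>saver\<close> can have \<open>pc\<^sub>1\<^sub>,\<^sub>2(G) \<ge> n - 2\<close>, and fifteen savers with at most seven vertices suffice. A tree
  that avoids the path \<open>P\<^sub>6\<close>, the spider with three legs of length two, and the double star with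
  subdivided center edge and two leaves at each center is a star, a double star or some
  \<open>T\<^sup>1(n\<^sub>1, n\<^sub>2)\<close>. A connected graph that is not a tree contains \<open>P\<^sub>6\<close> or one of \<open>C\<^sub>3\<close>, \<open>C\<^sub>4\<close>, \<open>C\<^sub>5\<close>. These
  cycles and the graphs of the list are closed under adding a pendant edge or an edge, except when
  a saver appears, so a largest embedded graph of this kind is the whole graph. The lower bounds
  come from inspecting the few paths between suitable pairs of vertices.\<close>

subsection \<open>Paths and colorings\<close>

text \<open>What passes from a subgraph to the whole graph is the saving, the number of vertices
  minus the number of colors, and not the number of colors: \<open>K_4\<close> needs one color,
  while the star inside it needs three. Upper bounds are therefore inherited as savings, whereas
  each lower bound is proved for the target graph itself. Only edges within a window of three
  consecutive ones have to differ, so colors can repeat with period three. This makes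
  \<open>P_6\<close> a saver with three colors on six vertices, disposes of every cycle of length at
  least six, and leaves a problem about small graphs, apart from stars and double stars with many
  leaves. No step deduces the structure of \<open>G\<close> from the value of \<open>pc12 G\<close>.
  The two lists and the graphs with saving three cover all cases, and their values
  \<open>n - 1\<close>, \<open>n - 2\<close> and at most \<open>n - 3\<close> exclude one another,
  so both equivalences follow from the implications in one direction.\<close>

fun spaced :: "nat list \<Rightarrow> bool" where
  "spaced (a # b # c # xs) \<longleftrightarrow> a \<noteq> b \<and> a \<noteq> c \<and> spaced (b # c # xs)"
| "spaced [a, b] \<longleftrightarrow> a \<noteq> b"
| "spaced _ \<longleftrightarrow> True"

text \<open>The recursion can be unfolded by evaluation and simplification on concrete paths. It
  compares each color with the next two only, and leaves the second against the third to the
  recursive call.\<close>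

lemma spaced_nth:
  "spaced xs \<longleftrightarrow> (\<forall>i j. i < j \<and> j < length xs \<and> j - i - 1 < 2 \<longrightarrow> xs ! i \<noteq> xs ! j)"
proof (induction xs rule: spaced.induct)
  case (1 a b c xs)
  let ?ys = "b # c # xs"
  have "(\<forall>i j. i < j \<and> j < length (a # ?ys) \<and> j - i - 1 < 2 \<longrightarrow> (a # ?ys) ! i \<noteq> (a # ?ys) ! j)
    \<longleftrightarrow> a \<noteq> b \<and> a \<noteq> c \<and>
      (\<forall>i j. i < j \<and> j < length ?ys \<and> j - i - 1 < 2 \<longrightarrow> ?ys ! i \<noteq> ?ys ! j)" (is "?L \<longleftrightarrow> ?R")
  proof
    assume L: ?L
    have "a \<noteq> b" using L[rule_format, of 0 1] by simp
    moreover have "a \<noteq> c" using L[rule_format, of 0 2] by simp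
    moreover have "?ys ! i \<noteq> ?ys ! j" if "i < j \<and> j < length ?ys \<and> j - i - 1 < 2" for i j
      using L[rule_format, of "Suc i" "Suc j"] that by simp
    ultimately show ?R by blast
  next
    assume R: ?R
    show ?L
    proof (intro allI impI)
      fix i j assume ij: "i < j \<and> j < length (a # ?ys) \<and> j - i - 1 < 2"
      show "(a # ?ys) ! i \<noteq> (a # ?ys) ! j"
      proof (cases i)
        case 0
        with ij have "j = 1 \<or> j = 2" by linarith
        with 0 R show ?thesis by auto
      next
        case (Suc i')
        then obtain j' where "j = Suc j'" using ij by (cases j) auto
        with Suc R ij show ?thesis by auto
      qed
    qed
  qed
  with 1 show ?case by simp
next
  case (2 a b)
  have "i < j \<and> j < length [a, b] \<and> j - i - 1 < 2 \<longleftrightarrow> i = 0 \<and> j = 1" for i j :: nat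
    by auto
  then show ?case by simp
qed auto

lemma spaced_fresh: "spaced xs \<Longrightarrow> m \<notin> set xs \<Longrightarrow> spaced (m # xs)"
  by (cases xs rule: spaced.cases) auto

lemma is_path_Cons:
  "is_path G (x # p) \<longleftrightarrow>
     x \<in> verts G \<and> x \<notin> set p \<and> (p = [] \<or> is_path G p \<and> {x, hd p} \<in> edges G)"
proof (cases p)
  case (Cons y q)
  have "(\<forall>i. Suc i < length (x # p) \<longrightarrow> {(x # p) ! i, (x # p) ! Suc i} \<in> edges G) \<longleftrightarrow>
    {x, y} \<in> edges G \<and> (\<forall>i. Suc i < length p \<longrightarrow> {p ! i, p ! Suc i} \<in> edges G)"
    (is "?L \<longleftrightarrow> ?R")
  proof
    assume L: ?L
    show ?R
    proof (intro conjI allI impI)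
      show "{x, y} \<in> edges G" using L[rule_format, of 0] Cons by simp
      show "{p ! i, p ! Suc i} \<in> edges G" if "Suc i < length p" for i
        using L[rule_format, of "Suc i"] that by simp
    qed
  next
    assume ?R
    show ?L
    proof (intro allI impI)
      fix i assume "Suc i < length (x # p)"
      with \<open>?R\<close> Cons show "{(x # p) ! i, (x # p) ! Suc i} \<in> edges G" by (cases i) auto
    qed
  qed
  with Cons show ?thesis unfolding is_path_def by auto
qed (simp add: is_path_def)

lemma not_is_path_Nil [simp]: "\<not> is_path G []"
  by (simp add: is_path_def)

lemma path_edges_simps [simp]:
  "path_edges [] = []" "path_edges [x] = []"
  "path_edges (x # y # p) = {x, y} # path_edges (y # p)"
proof -
  have "path_edges (x # y # p) =
      map (\<lambda>i. {(x # y # p) ! i, (x # y # p) ! Suc i}) (0 # map Suc [0..<length p])"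
    by (simp add: path_edges_def upt_conv_Cons map_Suc_upt del: upt_Suc)
  then show "path_edges (x # y # p) = {x, y} # path_edges (y # p)"
    by (simp add: path_edges_def)
qed (simp_all add: path_edges_def)

lemma dist2_proper_spaced: "dist2_proper c p \<longleftrightarrow> spaced (map c (path_edges p))"
  unfolding dist2_proper_def spaced_nth by auto

lemma path_edges_subset: "is_path G p \<Longrightarrow> set (path_edges p) \<subseteq> edges G"
  by (auto simp: is_path_def path_edges_def)

lemma path_edges_rev: "path_edges (rev p) = rev (path_edges p)"
proof (rule nth_equalityI)
  fix i assume "i < length (path_edges (rev p))"
  then have i: "Suc i < length p" by (simp add: path_edges_def)
  have "length p - Suc i = Suc (length p - Suc (Suc i))" "i < length p - Suc 0"
    "length p - Suc (Suc i) < length p - Suc 0" using i by linarith+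
  with i show "path_edges (rev p) ! i = rev (path_edges p) ! i"
    by (simp add: path_edges_def rev_nth insert_commute)
qed (simp add: path_edges_def)

lemma is_path_rev: "is_path G p \<Longrightarrow> is_path G (rev p)"
  unfolding is_path_def
proof (elim conjE, intro conjI allI impI)
  fix i assume e: "\<forall>i. Suc i < length p \<longrightarrow> {p ! i, p ! Suc i} \<in> edges G"
    and "Suc i < length (rev p)"
  then have i: "Suc i < length p" by simp
  have "length p - Suc i = Suc (length p - Suc (Suc i))" using i by linarith
  with e[rule_format, of "length p - Suc (Suc i)"] i
  show "{rev p ! i, rev p ! Suc i} \<in> edges G"
    by (simp add: rev_nth insert_commute)
qed auto

lemma dist2_proper_rev:
  assumes "dist2_proper c p" shows "dist2_proper c (rev p)"
  unfolding dist2_proper_def path_edges_rev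
proof (intro allI impI)
  fix i j
  let ?es = "path_edges p"
  assume ij: "i < j \<and> j < length (rev ?es) \<and> j - i - 1 < 2"
  then have "length ?es - Suc j < length ?es - Suc i" "length ?es - Suc i < length ?es"
    "length ?es - Suc i - (length ?es - Suc j) - 1 < 2" by auto
  then have "c (?es ! (length ?es - Suc j)) \<noteq> c (?es ! (length ?es - Suc i))"
    using assms unfolding dist2_proper_def by blast
  with ij show "c (rev ?es ! i) \<noteq> c (rev ?es ! j)" by (simp add: rev_nth)
qed

lemma is_path_mono:
  "is_path H p \<Longrightarrow> verts H \<subseteq> verts G \<Longrightarrow> edges H \<subseteq> edges G \<Longrightarrow> is_path G p"
  unfolding is_path_def by blast

lemma dist2_proper_cong:
  "(\<And>e. e \<in> set (path_edges p) \<Longrightarrow> c e = c' e) \<Longrightarrow> dist2_proper c p = dist2_proper c' p"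
  unfolding dist2_proper_spaced by (metis map_cong)

lemma simple_graph_edgeD:
  assumes "simple_graph G" "{x, y} \<in> edges G"
  shows "x \<in> verts G" "y \<in> verts G" "x \<noteq> y"
  using assms unfolding simple_graph_def by (auto simp: doubleton_eq_iff)

lemma simple_graph_edgeE:
  assumes "simple_graph G" "e \<in> edges G"
  obtains x y where "x \<in> verts G" "y \<in> verts G" "x \<noteq> y" "e = {x, y}"
  using assms unfolding simple_graph_def by blast

lemma finite_edges: "simple_graph G \<Longrightarrow> finite (edges G)"
  by (rule finite_subset[of _ "Pow (verts G)"]) (auto simp: simple_graph_def)

text \<open>A path from \<open>W\<close> to the outside has a first step that leaves
  \<open>W\<close>. This edge drives all growth arguments: for subgraphs, for spanning trees and for
  embeddings.\<close>

lemma connected_graph_leaving_edge: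
  assumes "connected_graph G" "W \<subseteq> verts G" "W \<noteq> {}" "W \<noteq> verts G"
  obtains x y where "x \<in> W" "y \<in> verts G - W" "{x, y} \<in> edges G"
proof -
  obtain a b where ab: "a \<in> W" "b \<in> verts G" "b \<notin> W" using assms by blast
  then obtain p where p: "is_path G p" "hd p = a" "last p = b"
    using assms unfolding connected_graph_def by blast
  have "\<exists>x y. x \<in> W \<and> y \<in> verts G - W \<and> {x, y} \<in> edges G"
    if "is_path G p" "hd p \<in> W" "last p \<notin> W" for p
    using that
  proof (induction p)
    case (Cons x p)
    then have p: "p \<noteq> []" by auto
    with Cons.prems have *: "is_path G p" "{x, hd p} \<in> edges G" "last p \<notin> W"
      by (auto simp: is_path_Cons)
    from * p have "hd p \<in> verts G" unfolding is_path_def by auto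
    with * Cons show ?case by (cases "hd p \<in> W") auto
  qed simp
  with p ab that show thesis by blast
qed

text \<open>\<open>saves d G\<close> says \<open>pc12 G \<le> card (verts G) - d\<close> without truncated subtraction.\<close>

definition saves :: "nat \<Rightarrow> 'a ugraph \<Rightarrow> bool" where
  "saves d G \<longleftrightarrow> (\<exists>c. pc12_coloring G c \<and> card (c ` edges G) + d \<le> card (verts G))"

lemma pc12_le:
  assumes "saves d G" shows "pc12 G + d \<le> card (verts G)"
proof -
  obtain c where c: "pc12_coloring G c" "card (c ` edges G) + d \<le> card (verts G)"
    using assms unfolding saves_def by blast
  have "pc12 G \<le> card (c ` edges G)" unfolding pc12_def
    by (rule Least_le) (use c in blast)
  with c show ?thesis by linarith
qed

lemma pc12_eq:
  assumes "saves d G" "\<And>c. pc12_coloring G c \<Longrightarrow> card (verts G) \<le> card (c ` edges G) + d"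
  shows "pc12 G = card (verts G) - d"
proof -
  obtain c where c: "pc12_coloring G c" "card (c ` edges G) + d \<le> card (verts G)"
    using assms unfolding saves_def by blast
  from c assms(2)[OF c(1)] have "card (c ` edges G) = card (verts G) - d" by linarith
  with c show ?thesis unfolding pc12_def
    by (intro Least_equality) (use assms(2) in fastforce)+
qed

section \<open>Growing a graph by pendant edges and by edges\<close>

definition add_leaf :: "'a ugraph \<Rightarrow> 'a \<Rightarrow> 'a \<Rightarrow> 'a ugraph" where
  "add_leaf G w x = \<lparr>verts = insert x (verts G), edges = insert {w, x} (edges G)\<rparr>"

lemma add_leaf_sel [simp]:
  "verts (add_leaf G w x) = insert x (verts G)"
  "edges (add_leaf G w x) = insert {w, x} (edges G)"
  by (simp_all add: add_leaf_def)

lemma simple_graph_add_leaf: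
  "simple_graph G \<Longrightarrow> w \<in> verts G \<Longrightarrow> x \<notin> verts G \<Longrightarrow> simple_graph (add_leaf G w x)"
  unfolding simple_graph_def by auto blast+

lemma is_path_add_leaf: "is_path G p \<Longrightarrow> is_path (add_leaf G w x) p"
  by (erule is_path_mono) auto

lemma is_path_leaf_Cons:
  "is_path G p \<Longrightarrow> hd p = w \<Longrightarrow> x \<notin> verts G \<Longrightarrow> is_path (add_leaf G w x) (x # p)"
  by (auto simp: is_path_Cons is_path_add_leaf insert_commute) (auto simp: is_path_def)

text \<open>The new edge takes a fresh color \<open>m\<close>, so vertices and colors both increase
  by one. Every path from the leaf is the new edge followed by a path from \<open>w\<close>.\<close>

lemma saves_add_leaf:
  assumes "saves d G" "simple_graph G" "w \<in> verts G" "x \<notin> verts G"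
  shows "saves d (add_leaf G w x)"
proof -
  let ?H = "add_leaf G w x"
  obtain c where c: "pc12_coloring G c" "card (c ` edges G) + d \<le> card (verts G)"
    using assms unfolding saves_def by blast
  have fin: "finite (verts G)" "finite (edges G)"
    using assms(2) finite_edges unfolding simple_graph_def by auto
  have new: "{w, x} \<notin> edges G" using simple_graph_edgeD assms by metis
  obtain m where m: "m \<notin> c ` edges G" using fin(2) ex_new_if_finite[of "c ` edges G"] by auto
  define c' where "c' = c({w, x} := m)"
  have old: "dist2_proper c' p = dist2_proper c p" if "is_path G p" for p
  proof (rule dist2_proper_cong)
    fix e assume "e \<in> set (path_edges p)"
    with path_edges_subset[OF that] new show "c' e = c e" by (auto simp: c'_def)
  qed
  have proper: "dist2_proper c' (x # p)" if "is_path G p" "hd p = w" "dist2_proper c p" for p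
  proof -
    have "p \<noteq> []" using that(1) by auto
    with that(2) obtain q where p: "p = w # q" by (metis list.collapse)
    have "spaced (map c' (path_edges p))" using old that dist2_proper_spaced by blast
    moreover have "m \<notin> set (map c' (path_edges p))"
      using m path_edges_subset[OF that(1)] new by (auto simp: c'_def)
    ultimately have "spaced (m # map c' (path_edges p))" by (rule spaced_fresh)
    moreover have "c' {x, w} = m" by (simp add: c'_def insert_commute)
    ultimately show ?thesis by (simp add: dist2_proper_spaced p)
  qed
  \<comment> \<open>The case \<open>u = v\<close> is included because the new leaf must also reach
    \<open>w\<close> itself, along the new edge alone.\<close>
  have ex: "\<exists>p. is_path G p \<and> hd p = u \<and> last p = v \<and> dist2_proper c p"
    if "u \<in> verts G" "v \<in> verts G" for u v
  proof (cases "u = v")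
    case True
    with that show ?thesis
      by (intro exI[of _ "[u]"]) (auto simp: is_path_def dist2_proper_def)
  next
    case False
    with c(1) that show ?thesis unfolding pc12_coloring_def by blast
  qed
  have "pc12_coloring ?H c'" unfolding pc12_coloring_def
  proof (intro ballI impI)
    fix u v assume uv: "u \<in> verts ?H" "v \<in> verts ?H" "u \<noteq> v"
    have leaf: "\<exists>p. is_path ?H p \<and> hd p = x \<and> last p = v \<and> dist2_proper c' p"
      if v: "v \<in> verts G" for v
    proof -
      obtain p where p: "is_path G p" "hd p = w" "last p = v" "dist2_proper c p"
        using ex[OF assms(3) v] by blast
      moreover have "p \<noteq> []" using p by auto
      ultimately have "hd (x # p) = x" "last (x # p) = v" by auto
      then show ?thesis using is_path_leaf_Cons[OF p(1,2) assms(4)] proper[OF p(1,2,4)] by blast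
    qed
    consider "u \<in> verts G" "v \<in> verts G" | "u = x" "v \<in> verts G" | "v = x" "u \<in> verts G"
      using uv by auto
    then show "\<exists>p. is_path ?H p \<and> hd p = u \<and> last p = v \<and> dist2_proper c' p"
    proof cases
      case 1
      then show ?thesis using ex old is_path_add_leaf by metis
    next
      case 2
      then show ?thesis using leaf by blast
    next
      case 3
      then obtain p where "is_path ?H p \<and> hd p = x \<and> last p = u \<and> dist2_proper c' p"
        using leaf by blast
      then have "is_path ?H (rev p) \<and> hd (rev p) = u \<and> last (rev p) = x \<and> dist2_proper c' (rev p)"
        using is_path_rev dist2_proper_rev
        by (metis hd_rev last_rev not_is_path_Nil)
      with 3 show ?thesis by blast
    qed
  qed
  moreover have "card (c' ` edges ?H) + d \<le> card (verts ?H)"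
  proof -
    have "c' ` edges ?H = insert m (c ` edges G)" using new by (auto simp: c'_def)
    then show ?thesis using c(2) m fin assms by simp
  qed
  ultimately show ?thesis unfolding saves_def by blast
qed

text \<open>The additional edges reuse a color that already occurs, and the paths of
  \<open>H\<close> remain available with unchanged colors.\<close>

lemma saves_add_edges:
  assumes "saves d H" "simple_graph G" "verts H = verts G" "edges H \<subseteq> edges G" "card (verts G) \<ge> 2"
  shows "saves d G"
proof -
  obtain c where c: "pc12_coloring H c" "card (c ` edges H) + d \<le> card (verts H)"
    using assms unfolding saves_def by blast
  \<comment> \<open>Two different vertices are joined by a path, which yields an edge
    \<open>e0\<close> of \<open>H\<close>; its color is the default for the edges outside
    \<open>H\<close>.\<close>
  have "\<exists>x y. x \<in> verts H \<and> y \<in> verts H \<and> x \<noteq> y"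
    using assms(2,3,5) card_le_Suc0_iff_eq[of "verts G"] unfolding simple_graph_def by force
  then obtain x y p where "x \<noteq> y" and p: "is_path H p" "hd p = x" "last p = y"
    using c(1) unfolding pc12_coloring_def by meson
  then obtain a q where "p = a # q" "q \<noteq> []" by (cases p) (auto split: if_splits)
  with p have "{a, hd q} \<in> edges H" by (auto simp: is_path_Cons)
  then obtain e0 where e0: "e0 \<in> edges H" by blast
  define c' where "c' = (\<lambda>e. if e \<in> edges H then c e else c e0)"
  have img: "c' ` edges G = c ` edges H" using e0 assms(4) by (auto simp: c'_def)
  have "dist2_proper c' p = dist2_proper c p" if "is_path H p" for p
    using path_edges_subset[OF that] by (intro dist2_proper_cong) (auto simp: c'_def)
  then have "pc12_coloring G c'"
    using c(1) assms(3,4) is_path_mono[of H _ G] unfolding pc12_coloring_def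
    by (metis order_refl)
  with c img assms show ?thesis unfolding saves_def by auto
qed

text \<open>A subgraph with \<open>k\<close> vertices that needs at most \<open>k - d\<close> colors can be grown to the whole
  graph by pendant edges, each taking a fresh color; the remaining edges need no new color.\<close>

lemma saves_mono:
  assumes "saves d H" "simple_graph H" "verts H \<noteq> {}" "verts H \<subseteq> verts G" "edges H \<subseteq> edges G"
    "simple_graph G" "connected_graph G" "card (verts G) \<ge> 2"
  shows "saves d G"
  using assms(1-5)
proof (induction "card (verts G - verts H)" arbitrary: H)
  case 0
  then have "verts H = verts G" using assms(6) by (auto simp: simple_graph_def)
  with 0 assms show ?case using saves_add_edges by blast
next
  case (Suc m)
  then have "verts H \<noteq> verts G" by auto
  with Suc.prems obtain x y where xy: "x \<in> verts H" "y \<in> verts G - verts H" "{x, y} \<in> edges G"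
    using connected_graph_leaving_edge[OF assms(7)] by metis
  have "verts G - verts (add_leaf H x y) = verts G - verts H - {y}" by auto
  then have "m = card (verts G - verts (add_leaf H x y))"
    using Suc.hyps(2) xy by simp
  then show ?case
  proof (rule Suc.hyps(1))
    show "saves d (add_leaf H x y)"
      by (rule saves_add_leaf) (use Suc.prems xy in auto)
    show "simple_graph (add_leaf H x y)"
      by (rule simple_graph_add_leaf) (use Suc.prems xy in auto)
  qed (use Suc.prems xy in auto)
qed

section \<open>Renaming vertices and isomorphisms\<close>

definition map_graph :: "('a \<Rightarrow> 'b) \<Rightarrow> 'a ugraph \<Rightarrow> 'b ugraph" where
  "map_graph f G = \<lparr>verts = f ` verts G, edges = (`) f ` edges G\<rparr>"

lemma map_graph_sel [simp]:
  "verts (map_graph f G) = f ` verts G" "edges (map_graph f G) = (`) f ` edges G"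
  by (simp_all add: map_graph_def)

lemma path_edges_map: "path_edges (map f p) = map ((`) f) (path_edges p)"
  by (auto simp: path_edges_def)

lemma is_path_map:
  assumes "is_path G p" "inj_on f (verts G)"
  shows "is_path (map_graph f G) (map f p)"
proof -
  have "{map f p ! i, map f p ! Suc i} \<in> (`) f ` edges G" if "Suc i < length p" for i
  proof -
    have "{p ! i, p ! Suc i} \<in> edges G" using assms(1) that unfolding is_path_def by blast
    then have "f ` {p ! i, p ! Suc i} \<in> (`) f ` edges G" by blast
    with that show ?thesis by simp
  qed
  with assms show ?thesis unfolding is_path_def
    by (auto simp: distinct_map intro: inj_on_subset)
qed

lemma simple_graph_map:
  assumes "simple_graph G" "inj_on f (verts G)" shows "simple_graph (map_graph f G)"
  unfolding simple_graph_def
proof (intro conjI ballI)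
  fix e assume "e \<in> edges (map_graph f G)"
  then obtain e' where e': "e' \<in> edges G" "e = f ` e'" by auto
  then obtain x y where "x \<in> verts G" "y \<in> verts G" "x \<noteq> y" "e' = {x, y}"
    using simple_graph_edgeE assms(1) by metis
  with e' assms have "f x \<in> verts (map_graph f G)" "f y \<in> verts (map_graph f G)" "f x \<noteq> f y" "e = {f x, f y}"
    by (auto simp: inj_on_eq_iff)
  then show "\<exists>x\<in>verts (map_graph f G). \<exists>y\<in>verts (map_graph f G). x \<noteq> y \<and> e = {x, y}"
    by blast
qed (use assms in \<open>simp add: simple_graph_def\<close>)

lemma map_graph_inverse:
  assumes "simple_graph G" "inj_on f (verts G)"
  shows "map_graph (inv_into (verts G) f) (map_graph f G) = G"
proof -
  have "inv_into (verts G) f ` f ` e = e" if "e \<in> edges G" for e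
    using assms that unfolding simple_graph_def by (auto simp: image_image)
  then show ?thesis
    using assms by (simp add: map_graph_def image_image)
qed

text \<open>A path of the image is carried back by the inverse of \<open>f\<close> on
  \<open>verts G\<close>. Mapping it forward again gives the original path, so the colors along it
  agree.\<close>

lemma pc12_coloring_map:
  assumes "simple_graph G" "inj_on f (verts G)" "pc12_coloring (map_graph f G) c"
  shows "pc12_coloring G (\<lambda>e. c (f ` e))"
  unfolding pc12_coloring_def
proof (intro ballI impI)
  fix x y assume xy: "x \<in> verts G" "y \<in> verts G" "x \<noteq> y"
  let ?g = "inv_into (verts G) f"
  have inj: "inj_on ?g (verts (map_graph f G))" by (simp add: inj_on_inv_into)
  obtain p where p: "is_path (map_graph f G) p" "hd p = f x" "last p = f y" "dist2_proper c p"
    using assms xy unfolding pc12_coloring_def by (metis image_eqI inj_on_eq_iff map_graph_sel(1))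
  have "is_path G (map ?g p)"
    using is_path_map[OF p(1) inj] map_graph_inverse[OF assms(1,2)] by simp
  moreover have "hd (map ?g p) = x" "last (map ?g p) = y"
    using p xy assms(2) by (metis hd_map inv_into_f_f is_path_def last_map)+
  moreover have "map f (map ?g p) = p"
    using p(1) unfolding is_path_def by (auto simp: f_inv_into_f subset_iff intro!: map_idI)
  then have "dist2_proper (\<lambda>e. c (f ` e)) (map ?g p)"
    using p(4) path_edges_map[of f "map ?g p"] unfolding dist2_proper_spaced
    by (simp add: comp_def)
  ultimately show "\<exists>p. is_path G p \<and> hd p = x \<and> last p = y \<and> dist2_proper (\<lambda>e. c (f ` e)) p"
    by blast
qed

lemma card_colors_map: "(\<lambda>e. c (f ` e)) ` edges G = c ` edges (map_graph f G)"
  by (simp add: image_image)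

lemma saves_map:
  assumes "simple_graph G" "inj_on f (verts G)" "saves d G"
  shows "saves d (map_graph f G)"
proof -
  let ?g = "inv_into (verts G) f"
  obtain c where c: "pc12_coloring G c" "card (c ` edges G) + d \<le> card (verts G)"
    using assms unfolding saves_def by blast
  have inv: "map_graph ?g (map_graph f G) = G" using map_graph_inverse assms by blast
  have "pc12_coloring (map_graph f G) (\<lambda>e. c (?g ` e))"
    using pc12_coloring_map[of "map_graph f G" ?g c] inv c simple_graph_map[OF assms(1,2)]
    by (simp add: inj_on_inv_into)
  moreover have "(\<lambda>e. c (?g ` e)) ` edges (map_graph f G) = c ` edges G"
    using card_colors_map[of c ?g "map_graph f G"] inv by simp
  ultimately show ?thesis using c assms(2) unfolding saves_def
    by (auto simp: card_image)
qed

lemma graph_iso_map: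
  assumes "simple_graph H" "inj_on f (verts H)"
  shows "graph_iso (map_graph f H) H"
proof -
  have e: "{x, y} \<in> edges H \<longleftrightarrow> {f x, f y} \<in> edges (map_graph f H)"
    if "x \<in> verts H" "y \<in> verts H" for x y
  proof
    assume "{f x, f y} \<in> edges (map_graph f H)"
    then obtain e where "e \<in> edges H" "f ` e = f ` {x, y}" by auto
    moreover have "e \<subseteq> verts H" using calculation assms(1) unfolding simple_graph_def by auto
    ultimately show "{x, y} \<in> edges H" using that assms(2)
      by (metis empty_subsetI inj_on_image_eq_iff insert_subset)
  next
    assume "{x, y} \<in> edges H"
    then have "f ` {x, y} \<in> edges (map_graph f H)" unfolding map_graph_sel by (rule imageI)
    then show "{f x, f y} \<in> edges (map_graph f H)" by (metis image_empty image_insert)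
  qed
  have f: "bij_betw f (verts H) (verts (map_graph f H))"
    using assms(2) by (simp add: bij_betw_def)
  let ?g = "inv_into (verts H) f"
  have "bij_betw ?g (verts (map_graph f H)) (verts H)" using f bij_betw_inv_into by blast
  moreover have "{x, y} \<in> edges (map_graph f H) \<longleftrightarrow> {?g x, ?g y} \<in> edges H"
    if "x \<in> verts (map_graph f H)" "y \<in> verts (map_graph f H)" for x y
    using e[of "?g x" "?g y"] that inv_into_into[of _ f "verts H"] f_inv_into_f[of _ f "verts H"]
    by (simp del: map_graph_sel(2))
  ultimately show ?thesis unfolding graph_iso_def by blast
qed

text \<open>The isomorphism is inverted so that \<open>G\<close> becomes literally a renamed copy of
  \<open>H\<close>; what is known about the concrete \<open>H\<close> then transfers along
  \<open>map_graph\<close>.\<close>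

lemma graph_isoE:
  assumes "graph_iso G H" "simple_graph G" "simple_graph H"
  obtains f where "inj_on f (verts H)" "G = map_graph f H"
proof -
  obtain f where f: "bij_betw f (verts G) (verts H)"
    and e: "\<And>x y. x \<in> verts G \<Longrightarrow> y \<in> verts G \<Longrightarrow> {x, y} \<in> edges G \<longleftrightarrow> {f x, f y} \<in> edges H"
    using assms(1) unfolding graph_iso_def by blast
  have "edges (map_graph f G) = edges H"
  proof (intro equalityI subsetI)
    fix a assume "a \<in> edges (map_graph f G)"
    then obtain x y where "x \<in> verts G" "y \<in> verts G" "{x, y} \<in> edges G" "a = f ` {x, y}"
      using simple_graph_edgeE[OF assms(2)] by (metis imageE map_graph_sel(2))
    then show "a \<in> edges H" using e by simp
  next
    fix a assume a: "a \<in> edges H"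
    then obtain u v where "u \<in> verts H" "v \<in> verts H" "a = {u, v}"
      using simple_graph_edgeE assms(3) by metis
    moreover have "verts H = f ` verts G" using f by (simp add: bij_betw_def)
    ultimately obtain x y where "x \<in> verts G" "y \<in> verts G" "a = {f x, f y}" by auto
    with a e show "a \<in> edges (map_graph f G)" by (force intro!: image_eqI[of _ _ "{x, y}"])
  qed
  then have H: "H = map_graph f G" using f by (simp add: map_graph_def bij_betw_def)
  have inj: "inj_on f (verts G)" using f by (simp add: bij_betw_def)
  show thesis
  proof (rule that)
    show "inj_on (inv_into (verts G) f) (verts H)" using H by (simp add: inj_on_inv_into)
    show "G = map_graph (inv_into (verts G) f) H" using H map_graph_inverse[OF assms(2) inj] by simp
  qed
qed

subsection \<open>Graphs given by edge lists\<close>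

definition coded :: "nat \<times> (nat \<times> nat) list \<Rightarrow> nat ugraph" where
  "coded = (\<lambda>(k, es). \<lparr>verts = {..<k}, edges = (\<lambda>(i, j). {i, j}) ` set es\<rparr>)"

lemma coded_sel [simp]:
  "verts (coded (k, es)) = {..<k}" "edges (coded (k, es)) = (\<lambda>(i, j). {i, j}) ` set es"
  by (simp_all add: coded_def)

text \<open>Listing the smaller endpoint first gives each edge one normal form, on which
  \<open>edge_color\<close> relies. The condition \<open>k \<noteq> 0\<close> provides the nonempty
  subgraph from which \<open>saves_mono\<close> grows.\<close>

definition valid_code :: "nat \<times> (nat \<times> nat) list \<Rightarrow> bool" where
  "valid_code = (\<lambda>(k, es). k \<noteq> 0 \<and> list_all (\<lambda>(i, j). i < j \<and> j < k) es)"

lemma valid_codeD: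
  "valid_code (k, es) \<Longrightarrow> (i, j) \<in> set es \<Longrightarrow> i < j \<and> j < k"
  by (auto simp: valid_code_def list_all_iff)

lemma simple_graph_coded: "valid_code s \<Longrightarrow> simple_graph (coded s)"
proof (cases s)
  case (Pair k es)
  assume "valid_code s"
  then have "\<exists>x\<in>verts (coded s). \<exists>y\<in>verts (coded s). x \<noteq> y \<and> {i, j} = {x, y}"
    if "(i, j) \<in> set es" for i j
    using valid_codeD[of k es i j] that Pair
    by (intro bexI[of _ i] bexI[of _ j]) auto
  then show ?thesis by (auto simp: simple_graph_def Pair)
qed

definition adj :: "(nat \<times> nat) list \<Rightarrow> nat \<Rightarrow> nat \<Rightarrow> bool" where
  "adj es i j \<longleftrightarrow> (i, j) \<in> set es \<or> (j, i) \<in> set es"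

lemma adj_iff: "adj es i j \<longleftrightarrow> {i, j} \<in> edges (coded (k, es))"
  by (auto simp: adj_def doubleton_eq_iff image_iff)

text \<open>The paths from \<open>x\<close> with at most \<open>n\<close> edges that avoid \<open>vs\<close>.\<close>

primrec paths_from :: "nat \<Rightarrow> (nat \<times> nat) list \<Rightarrow> nat \<Rightarrow> nat list \<Rightarrow> nat \<Rightarrow> nat list list" where
  "paths_from k es 0 vs x = [[x]]"
| "paths_from k es (Suc n) vs x =
     [x] # map (Cons x) (concat (map (paths_from k es n (x # vs))
       (filter (\<lambda>y. adj es x y \<and> y \<notin> set (x # vs)) [0..<k])))"

text \<open>Soundness serves the upper bounds, where one proper path per pair has to exist.
  Completeness, proved next, serves the lower bounds, where all paths between two vertices have to
  be inspected.\<close>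

lemma paths_from_sound:
  "p \<in> set (paths_from k es n vs x) \<Longrightarrow> x < k \<Longrightarrow> x \<notin> set vs \<Longrightarrow>
     is_path (coded (k, es)) p \<and> hd p = x \<and> set p \<inter> set vs = {}"
proof (induction n arbitrary: p vs x)
  case 0
  then show ?case by (simp add: is_path_Cons)
next
  case (Suc n)
  show ?case
  proof (cases "p = [x]")
    case True
    with Suc.prems show ?thesis by (simp add: is_path_Cons)
  next
    case False
    with Suc.prems(1) obtain y q where y: "adj es x y" "y < k" "y \<notin> set (x # vs)" "p = x # q"
      "q \<in> set (paths_from k es n (x # vs) y)"
      by auto
    from Suc.IH[OF y(5,2,3)] have q: "is_path (coded (k, es)) q" "hd q = y" "set q \<inter> set (x # vs) = {}"
      by blast+
    then show ?thesis using y Suc.prems adj_iff[of es x y k] by (auto simp: is_path_Cons)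
  qed
qed

lemma paths_from_complete:
  "is_path (coded (k, es)) p \<Longrightarrow> hd p = x \<Longrightarrow> set p \<inter> set vs = {} \<Longrightarrow> length p \<le> Suc n \<Longrightarrow>
     p \<in> set (paths_from k es n vs x)"
proof (induction n arbitrary: p vs x)
  case 0
  then show ?case by (cases p) auto
next
  case (Suc n)
  then have "p \<noteq> []" by auto
  with Suc.prems(2) obtain q where p: "p = x # q" by (metis list.collapse)
  show ?case
  proof (cases "q = []")
    case False
    have q: "is_path (coded (k, es)) q" "adj es x (hd q)" "x \<notin> set q"
      using Suc.prems(1) p False adj_iff[of es x "hd q" k] by (auto simp: is_path_Cons)
    then have "q \<in> set (paths_from k es n (x # vs) (hd q))"
      using Suc.prems p by (intro Suc.IH) auto
    moreover have "set q \<subseteq> {..<k}" "set q \<inter> set (x # vs) = {}"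
      using q(1,3) Suc.prems(3) p by (auto simp: is_path_def)
    with hd_in_set[OF False] have "hd q < k" "hd q \<notin> set (x # vs)" by blast+
    ultimately show ?thesis using p q(2) by auto
  qed (use p in simp)
qed

text \<open>A path may traverse an edge in either direction, so the pair is sorted before it is
  looked up in the color list that runs parallel to \<open>es\<close>.\<close>

definition edge_color :: "(nat \<times> nat) list \<Rightarrow> nat list \<Rightarrow> nat \<Rightarrow> nat \<Rightarrow> nat" where
  "edge_color es cs i j = the (map_of (zip es cs) (min i j, max i j))"

text \<open>An executable certificate for a saving of \<open>d\<close>. The depth \<open>k\<close>
  suffices for the search, as a path has at most \<open>k\<close> vertices.\<close>

definition saving_check :: "nat \<Rightarrow> nat \<times> (nat \<times> nat) list \<Rightarrow> nat list \<Rightarrow> bool" where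
  "saving_check d s cs \<longleftrightarrow> valid_code s \<and> (case s of (k, es) \<Rightarrow>
     length cs = length es \<and> length (remdups cs) + d \<le> k \<and>
     list_all (\<lambda>i. list_all (\<lambda>j. i = j \<or>
        list_ex (\<lambda>p. last p = j \<and> spaced (map2 (edge_color es cs) p (tl p))) (paths_from k es k [] i))
       [0..<k]) [0..<k])"

lemma saves_coded:
  assumes "saving_check d s cs" shows "saves d (coded s)"
proof -
  obtain k es where s: "s = (k, es)" by (cases s)
  \<comment> \<open>\<open>Min\<close> and \<open>Max\<close> recover the listed pair from the
    unordered edge, which turns the color list into a coloring of sets.\<close>
  define c where "c e = the (map_of (zip es cs) (Min e, Max e))" for e
  have c: "edge_color es cs i j = c {i, j}" for i j
    by (simp add: edge_color_def c_def)
  have colors: "map2 (edge_color es cs) p (tl p) = map c (path_edges p)" for p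
    by (induction p rule: induct_list012) (simp_all add: c)
  note check = assms[unfolded saving_check_def s prod.case]
  have len: "length es = length cs" using check by simp
  have "c {i, j} \<in> set cs" if ij: "(i, j) \<in> set es" for i j
  proof -
    have "i < j" using ij check valid_codeD by blast
    then have "c {i, j} = the (map_of (zip es cs) (i, j))" by (simp add: c_def)
    moreover obtain y where "map_of (zip es cs) (i, j) = Some y"
      using map_of_zip_is_Some[OF len] ij by metis
    ultimately show ?thesis by (metis map_of_SomeD option.sel set_zip_rightD)
  qed
  then have "c ` edges (coded s) \<subseteq> set cs" unfolding s by auto
  then have "card (c ` edges (coded s)) \<le> length (remdups cs)"
    by (metis card_mono length_remdups_card_conv List.finite_set)
  moreover have "pc12_coloring (coded s) c" unfolding pc12_coloring_def
  proof (intro ballI impI)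
    fix x y assume xy: "x \<in> verts (coded s)" "y \<in> verts (coded s)" "x \<noteq> y"
    then have "x \<in> {0..<k}" "y \<in> {0..<k}" by (auto simp: s)
    then have "\<exists>p\<in>set (paths_from k es k [] x). last p = y \<and> spaced (map2 (edge_color es cs) p (tl p))"
      using check xy(3) unfolding list_all_iff list_ex_iff set_upt by blast
    with xy show "\<exists>p. is_path (coded s) p \<and> hd p = x \<and> last p = y \<and> dist2_proper c p"
      using paths_from_sound[of _ k es k "[]" x] unfolding colors dist2_proper_spaced s by force
  qed
  ultimately show ?thesis using check unfolding saves_def s by auto
qed

section \<open>Embeddings of coded graphs and their one-step extensions\<close>

definition embedded :: "nat \<times> (nat \<times> nat) list \<Rightarrow> 'a list \<Rightarrow> 'a ugraph \<Rightarrow> bool" where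
  "embedded = (\<lambda>(k, es) xs G. distinct xs \<and> length xs = k \<and> set xs \<subseteq> verts G \<and>
     (\<forall>(i, j)\<in>set es. {xs ! i, xs ! j} \<in> edges G))"

lemma embedded_image:
  assumes "embedded s xs G" "valid_code s"
  shows "inj_on ((!) xs) (verts (coded s))" "verts (map_graph ((!) xs) (coded s)) = set xs"
    "edges (map_graph ((!) xs) (coded s)) \<subseteq> edges G"
proof -
  obtain k es where s: "s = (k, es)" by (cases s)
  note emb = assms(1)[unfolded embedded_def s prod.case]
  show "inj_on ((!) xs) (verts (coded s))" using emb by (auto simp: s inj_on_nth)
  show "verts (map_graph ((!) xs) (coded s)) = set xs" using emb by (auto simp: s set_conv_nth)
  show "edges (map_graph ((!) xs) (coded s)) \<subseteq> edges G" using emb by (auto simp: s)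
qed

text \<open>The image need not be an induced subgraph: further edges of \<open>G\<close> between its
  vertices are colored at no cost by \<open>saves_mono\<close>.\<close>

lemma saves_embedded:
  assumes "saves d (coded s)" "embedded s xs G" "valid_code s"
    "simple_graph G" "connected_graph G" "card (verts G) \<ge> 2"
  shows "saves d G"
proof (rule saves_mono)
  show "saves d (map_graph ((!) xs) (coded s))"
    using saves_map simple_graph_coded embedded_image assms by blast
  show "simple_graph (map_graph ((!) xs) (coded s))"
    using simple_graph_map simple_graph_coded embedded_image assms by blast
  show "verts (map_graph ((!) xs) (coded s)) \<noteq> {}"
    using embedded_image(2)[OF assms(2,3)] assms(2,3)
    by (cases s) (auto simp: embedded_def valid_code_def)
  show "verts (map_graph ((!) xs) (coded s)) \<subseteq> verts G"
    using embedded_image(2)[OF assms(2,3)] assms(2) by (cases s) (simp add: embedded_def)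
qed (use embedded_image[OF assms(2,3)] assms in auto)

text \<open>Renumbering by \<open>ps\<close> may reverse the order of the endpoints, hence
  \<open>adj\<close> in place of membership in the edge list.\<close>

definition embedding_check ::
    "nat \<times> (nat \<times> nat) list \<Rightarrow> nat list \<Rightarrow> nat \<times> (nat \<times> nat) list \<Rightarrow> bool" where
  "embedding_check = (\<lambda>(k', es') ps (k, es). length ps = k' \<and> distinct ps \<and> list_all (\<lambda>v. v < k) ps \<and>
     list_all (\<lambda>(i, j). adj es (ps ! i) (ps ! j)) es')"

lemma embedded_trans:
  assumes "embedding_check s ps t" "embedded t xs G" "valid_code s"
  shows "embedded s (map ((!) xs) ps) G"
proof -
  obtain k es k' es' where st: "t = (k, es)" "s = (k', es')" by (metis surj_pair)
  note check = assms(1)[unfolded embedding_check_def st prod.case list_all_iff]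
  note emb = assms(2)[unfolded embedded_def st prod.case]
  have "distinct (map ((!) xs) ps)"
    using check emb by (auto simp: distinct_map inj_on_def nth_eq_iff_index_eq)
  moreover have "set (map ((!) xs) ps) \<subseteq> verts G"
    using check emb by (auto simp: subset_iff)
  moreover have "{map ((!) xs) ps ! i, map ((!) xs) ps ! j} \<in> edges G" if "(i, j) \<in> set es'" for i j
  proof -
    have "i < length ps" "j < length ps"
      using valid_codeD[OF assms(3)[unfolded st] that] check by auto
    moreover have "adj es (ps ! i) (ps ! j)" using check that by blast
    then have "{xs ! (ps ! i), xs ! (ps ! j)} \<in> edges G"
      using emb by (auto simp: adj_def insert_commute)
    ultimately show ?thesis by simp
  qed
  ultimately show ?thesis using check by (auto simp: embedded_def st)
qed

text \<open>Symmetric duplicates are kept. The order, pendant edges first and then missing edges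
  sorted by their larger endpoint, is the one that the table of witnesses follows.\<close>

definition extensions ::
    "nat \<times> (nat \<times> nat) list \<Rightarrow> (nat \<times> (nat \<times> nat) list) list" where
  "extensions = (\<lambda>(k, es). map (\<lambda>i. (Suc k, (i, k) # es)) [0..<k] @
     map (\<lambda>e. (k, e # es)) (filter (\<lambda>e. e \<notin> set es)
       (concat (map (\<lambda>j. map (\<lambda>i. (i, j)) [0..<j]) [0..<k]))))"

lemma in_extensions:
  "i < k \<Longrightarrow> (Suc k, (i, k) # es) \<in> set (extensions (k, es))"
  "i < j \<Longrightarrow> j < k \<Longrightarrow> (i, j) \<notin> set es \<Longrightarrow> (k, (i, j) # es) \<in> set (extensions (k, es))"
  by (auto simp: extensions_def image_iff)

text \<open>If the image misses a vertex, connectedness gives an edge that leaves it, hence a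
  pendant edge. If it covers all vertices but is not \<open>G\<close>, some edge of \<open>G\<close>
  is missing. Thus a proper enlargement of a shape always contains one of finitely many
  extensions.\<close>

lemma embedded_extension:
  assumes "embedded s xs G" "valid_code s" "simple_graph G" "connected_graph G"
    "G \<noteq> map_graph ((!) xs) (coded s)"
  obtains t ys where "t \<in> set (extensions s)" "embedded t ys G"
proof (cases "set xs = verts G")
  case False
  obtain k es where s: "s = (k, es)" by (cases s)
  note emb = assms(1)[unfolded embedded_def s prod.case]
  have "xs \<noteq> []" using emb assms(2) by (auto simp: s valid_code_def)
  with emb False obtain x y where xy: "x \<in> set xs" "y \<in> verts G - set xs" "{x, y} \<in> edges G"
    using connected_graph_leaving_edge[OF assms(4), of "set xs"] by (metis set_empty)
  then obtain i where i: "i < k" "xs ! i = x" using emb by (auto simp: in_set_conv_nth)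
  have "embedded (Suc k, (i, k) # es) (xs @ [y]) G"
    using emb xy i valid_codeD[OF assms(2)[unfolded s]]
    by (fastforce simp: embedded_def nth_append)
  with in_extensions(1)[OF i(1)] s that show thesis by blast
next
  case True
  obtain k es where s: "s = (k, es)" by (cases s)
  note emb = assms(1)[unfolded embedded_def s prod.case]
  have "edges G \<noteq> edges (map_graph ((!) xs) (coded s))"
    using assms(5) True embedded_image(2)[OF assms(1,2)] by (metis ugraph.surjective unit.exhaust)
  then obtain e where e: "e \<in> edges G" "e \<notin> edges (map_graph ((!) xs) (coded s))"
    using embedded_image(3)[OF assms(1,2)] by blast
  then obtain x y where xy: "x \<in> set xs" "y \<in> set xs" "x \<noteq> y" "e = {x, y}"
    using simple_graph_edgeE[OF assms(3)] True by metis
  then obtain i j where "i < k" "j < k" "xs ! i = x" "xs ! j = y" "i \<noteq> j"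
    using emb by (metis in_set_conv_nth)
  then obtain i j where ij: "i < j" "j < k" "e = {xs ! i, xs ! j}"
    using xy(4) by (metis insert_commute linorder_neqE_nat)
  have "(i, j) \<notin> set es"
  proof
    assume "(i, j) \<in> set es"
    then have "{i, j} \<in> edges (coded s)" by (force simp: s)
    then have "(!) xs ` {i, j} \<in> edges (map_graph ((!) xs) (coded s))"
      unfolding map_graph_sel by (rule imageI)
    with e ij show False by simp
  qed
  moreover have "embedded (k, (i, j) # es) xs G"
    using emb e(1) ij by (simp add: embedded_def)
  ultimately show thesis using in_extensions(2)[OF ij(1,2)] s that by blast
qed

subsection \<open>Shapes and savers\<close>

text \<open>The cycles \<open>C\<^sub>3\<close>, \<open>C\<^sub>4\<close>, \<open>C\<^sub>5\<close>, followed by the graphs of the list \<open>\<L>\<close> in their order.\<close>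

definition shapes :: "(nat \<times> (nat \<times> nat) list) list" where
  "shapes =
    [(3, [(0, 1), (1, 2), (0, 2)]),
     (4, [(0, 1), (1, 2), (2, 3), (0, 3)]),
     (5, [(0, 1), (1, 2), (2, 3), (3, 4), (0, 4)]),
     (4, [(0, 1), (1, 2), (0, 2), (0, 3)]),
     (4, [(0, 1), (1, 2), (0, 2), (1, 3), (2, 3)]),
     (5, [(0, 1), (1, 2), (2, 3), (0, 3), (0, 4)]),
     (5, [(0, 1), (1, 2), (0, 2), (0, 3), (0, 4)]),
     (5, [(0, 1), (1, 2), (0, 2), (0, 3), (1, 4)]),
     (5, [(0, 1), (1, 2), (0, 2), (0, 3), (3, 4)]),
     (5, [(0, 1), (1, 2), (1, 3), (2, 3), (2, 4), (3, 4)]),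
     (6, [(0, 4), (1, 4), (0, 1), (4, 5), (2, 5), (3, 5)])]"

text \<open>\<open>P\<^sub>6\<close>, the spider and the subdivided double star come first; only these are trees. The other
  graphs arise from a shape by adding an edge or a pendant edge.\<close>

definition savers :: "(nat \<times> (nat \<times> nat) list) list" where
  "savers =
    [(6, [(0, 1), (1, 2), (2, 3), (3, 4), (4, 5)]),
     (7, [(0, 1), (1, 2), (0, 3), (3, 4), (0, 5), (5, 6)]),
     (7, [(0, 1), (1, 2), (1, 3), (0, 4), (4, 5), (4, 6)]),
     (4, [(0, 1), (0, 2), (0, 3), (1, 2), (1, 3), (2, 3)]),
     (5, [(0, 1), (0, 2), (0, 4), (1, 2), (2, 3), (3, 4)]),
     (5, [(0, 1), (0, 2), (1, 2), (1, 3), (1, 4), (2, 3)]),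
     (5, [(0, 1), (0, 3), (0, 4), (1, 2), (2, 3), (2, 4)]),
     (5, [(0, 1), (0, 2), (0, 3), (0, 4), (1, 2), (3, 4)]),
     (6, [(0, 1), (0, 3), (0, 4), (0, 5), (1, 2), (2, 3)]),
     (6, [(0, 1), (0, 3), (0, 4), (1, 2), (2, 3), (2, 5)]),
     (6, [(0, 1), (0, 2), (0, 3), (0, 4), (0, 5), (1, 2)]),
     (6, [(0, 1), (0, 2), (0, 3), (0, 4), (1, 2), (1, 5)]),
     (6, [(0, 1), (0, 2), (0, 3), (0, 4), (1, 2), (3, 5)]),
     (6, [(0, 1), (0, 2), (0, 3), (1, 2), (1, 4), (2, 5)]),
     (7, [(0, 1), (0, 4), (1, 4), (2, 5), (3, 5), (4, 5), (5, 6)])]"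

text \<open>The colors of the edges, in the order of the edge lists.\<close>

definition shape_colors :: "nat list list" where
  "shape_colors =
    [[0, 0, 0],
     [0, 0, 1, 0],
     [0, 0, 1, 2, 0],
     [0, 0, 0, 1],
     [0, 0, 0, 0, 1],
     [0, 0, 2, 0, 1],
     [0, 0, 0, 1, 2],
     [0, 0, 0, 1, 2],
     [0, 0, 0, 1, 2],
     [0, 0, 1, 0, 0, 2],
     [0, 0, 0, 3, 1, 2]]"

definition saver_colors :: "nat list list" where
  "saver_colors =
    [[0, 1, 2, 0, 1],
     [0, 3, 1, 3, 2, 3],
     [0, 2, 3, 1, 2, 3],
     [0, 0, 0, 0, 0, 0],
     [0, 0, 1, 0, 1, 0],
     [0, 0, 0, 0, 1, 1],
     [0, 0, 1, 0, 1, 0],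
     [0, 0, 1, 1, 0, 0],
     [0, 0, 1, 2, 1, 2],
     [0, 0, 1, 0, 2, 1],
     [0, 1, 0, 1, 2, 2],
     [0, 0, 1, 2, 1, 2],
     [0, 1, 0, 1, 2, 2],
     [0, 1, 2, 2, 1, 0],
     [0, 1, 2, 0, 1, 3, 2]]"

text \<open>For each shape and each of its extensions, the position in \<open>shapes @ savers\<close> of a graph contained
  in the extension, and the list of the images of its vertices.\<close>

definition grow_witnesses :: "(nat \<times> nat list) list list" where
  "grow_witnesses =
    [[(3, [0, 1, 2, 3]), (3, [1, 0, 2, 3]), (3, [2, 0, 1, 3])],
     [(5, [0, 1, 2, 3, 4]), (5, [1, 0, 3, 2, 4]), (5, [2, 1, 0, 3, 4]), (5, [3, 0, 1, 2, 4]),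
      (4, [1, 0, 2, 3]), (4, [0, 1, 3, 2])],
     [(11, [1, 2, 3, 4, 0, 5]), (11, [0, 4, 3, 2, 1, 5]), (11, [1, 0, 4, 3, 2, 5]),
      (11, [2, 1, 0, 4, 3, 5]), (11, [0, 1, 2, 3, 4, 5]), (15, [0, 1, 2, 3, 4]),
      (15, [0, 4, 3, 2, 1]), (15, [1, 2, 3, 4, 0]), (15, [1, 0, 4, 3, 2]),
      (15, [2, 3, 4, 0, 1])],
     [(6, [0, 1, 2, 3, 4]), (7, [0, 1, 2, 3, 4]), (7, [0, 2, 1, 3, 4]), (8, [0, 1, 2, 3, 4]),
      (4, [2, 0, 1, 3]), (4, [1, 0, 2, 3])],
     [(9, [4, 0, 1, 2, 3]), (16, [0, 1, 2, 3, 4]), (16, [0, 2, 1, 3, 4]),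
      (9, [4, 3, 1, 2, 0]), (14, [0, 1, 2, 3])],
     [(19, [0, 1, 2, 3, 4, 5]), (11, [4, 0, 3, 2, 1, 5]), (20, [0, 1, 2, 3, 4, 5]),
      (11, [4, 0, 1, 2, 3, 5]), (11, [1, 2, 3, 0, 4, 5]), (16, [1, 0, 2, 3, 4]),
      (9, [4, 0, 1, 3, 2]), (15, [0, 4, 1, 2, 3]), (17, [0, 1, 2, 3, 4]),
      (15, [0, 4, 3, 2, 1])],
     [(21, [0, 1, 2, 3, 4, 5]), (22, [0, 1, 2, 3, 4, 5]), (22, [0, 2, 1, 3, 4, 5]),
      (23, [0, 1, 2, 3, 4, 5]), (23, [0, 1, 2, 4, 3, 5]), (16, [2, 0, 1, 3, 4]),
      (16, [1, 0, 2, 3, 4]), (16, [2, 0, 1, 4, 3]), (16, [1, 0, 2, 4, 3]),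
      (18, [0, 1, 2, 3, 4])],
     [(22, [0, 1, 2, 3, 5, 4]), (22, [1, 0, 2, 4, 5, 3]), (24, [0, 1, 2, 3, 4, 5]),
      (11, [4, 1, 2, 0, 3, 5]), (11, [3, 0, 2, 1, 4, 5]), (16, [2, 1, 0, 3, 4]),
      (9, [4, 1, 0, 2, 3]), (16, [2, 0, 1, 4, 3]), (9, [3, 0, 1, 2, 4]),
      (15, [0, 2, 1, 4, 3])],
     [(23, [0, 1, 2, 3, 5, 4]), (11, [4, 3, 0, 2, 1, 5]), (11, [4, 3, 0, 1, 2, 5]),
      (10, [1, 2, 4, 5, 0, 3]), (11, [1, 2, 0, 3, 4, 5]), (9, [4, 3, 0, 1, 2]),
      (9, [4, 3, 0, 2, 1]), (18, [0, 1, 2, 3, 4]), (15, [0, 2, 1, 4, 3]),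
      (15, [0, 1, 2, 4, 3])],
     [(11, [2, 4, 3, 1, 0, 5]), (19, [1, 2, 4, 3, 0, 5]), (11, [0, 1, 3, 4, 2, 5]),
      (11, [0, 1, 2, 4, 3, 5]), (11, [0, 1, 2, 3, 4, 5]), (15, [1, 0, 2, 4, 3]),
      (15, [1, 0, 3, 4, 2]), (15, [1, 2, 3, 4, 0]), (14, [1, 2, 3, 4])],
     [(11, [2, 5, 4, 1, 0, 6]), (11, [2, 5, 4, 0, 1, 6]), (11, [0, 1, 4, 5, 2, 6]),
      (11, [0, 1, 4, 5, 3, 6]), (23, [4, 0, 1, 5, 6, 2]), (25, [0, 1, 2, 3, 4, 5, 6]),
      (11, [1, 4, 0, 2, 5, 3]), (11, [0, 4, 1, 2, 5, 3]), (11, [1, 4, 0, 3, 5, 2]),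
      (11, [0, 4, 1, 3, 5, 2]), (11, [0, 1, 4, 5, 2, 3]), (11, [0, 1, 4, 2, 5, 3]),
      (11, [0, 1, 4, 3, 5, 2]), (19, [5, 0, 1, 4, 2, 3]), (19, [5, 1, 0, 4, 2, 3])]]"


text \<open>An index below \<open>length shapes\<close> points to a shape, a larger one to a saver.
  Only for shapes is an increase in size demanded, since only there does the argument have to go
  on.\<close>

definition grow_check ::
    "nat \<times> (nat \<times> nat) list \<Rightarrow> nat \<times> (nat \<times> nat) list \<Rightarrow> nat \<times> nat list \<Rightarrow> bool" where
  "grow_check s t = (\<lambda>(i, ps). if i < length shapes
     then fst s + length (snd s) < fst (shapes ! i) + length (snd (shapes ! i)) \<and>
       embedding_check (shapes ! i) ps t
     else i - length shapes < length savers \<and> embedding_check (savers ! (i - length shapes)) ps t)"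

lemma shapes_check: "list_all2 (saving_check 2) shapes shape_colors"
  by code_simp

lemma savers_check: "list_all2 (saving_check 3) savers saver_colors"
  by code_simp

lemma extensions_check:
  "list_all2 (\<lambda>s. list_all2 (grow_check s) (extensions s)) shapes grow_witnesses"
  by code_simp

lemma list_all2_ex: "list_all2 P xs ys \<Longrightarrow> x \<in> set xs \<Longrightarrow> \<exists>y. P x y"
  by (metis list_all2_conv_all_nth in_set_conv_nth)

lemma shapes_saves: "s \<in> set shapes \<Longrightarrow> valid_code s \<and> saves 2 (coded s)"
  using list_all2_ex[OF shapes_check] saves_coded saving_check_def by blast

lemma savers_saves: "s \<in> set savers \<Longrightarrow> valid_code s \<and> saves 3 (coded s)"
  using list_all2_ex[OF savers_check] saves_coded saving_check_def by blast

lemma shapes_grow: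
  assumes "s \<in> set shapes" "t \<in> set (extensions s)"
  obtains s' ps where "s' \<in> set savers" "embedding_check s' ps t"
  | s' ps where "s' \<in> set shapes" "embedding_check s' ps t"
      "fst s + length (snd s) < fst s' + length (snd s')"
proof -
  obtain i ps where "grow_check s t (i, ps)"
    using list_all2_ex[OF extensions_check assms(1)] list_all2_ex[OF _ assms(2)]
    by (metis surj_pair)
  then show thesis using that unfolding grow_check_def
    by (metis (no_types, lifting) case_prod_conv nth_mem)
qed

lemma shape_or_saves:
  assumes "simple_graph G" "connected_graph G" "card (verts G) \<ge> 2"
    and "s0 \<in> set shapes" "embedded s0 xs0 G"
  shows "saves 3 G \<or> (\<exists>s\<in>set shapes. \<exists>xs. embedded s xs G \<and> G = map_graph ((!) xs) (coded s))"
proof -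
  \<comment> \<open>Edges are counted along with vertices because some steps between shapes only add
    an edge, for example from \<open>C_4\<close> to \<open>K_4\<close> minus an edge.\<close>
  let ?size = "\<lambda>s :: nat \<times> (nat \<times> nat) list. fst s + length (snd s)"
  let ?S = "{s \<in> set shapes. \<exists>xs. embedded s xs G}"
  have fin: "finite (?size ` ?S)" by simp
  have "?size ` ?S \<noteq> {}" using assms(4,5) by blast
  from Max_in[OF fin this] obtain s where "s \<in> ?S" and size: "?size s = Max (?size ` ?S)" by force
  have max: "?size t \<le> ?size s" if "t \<in> ?S" for t
    unfolding size using fin imageI[OF that] by (rule Max_ge)
  from \<open>s \<in> ?S\<close> obtain xs where s: "s \<in> set shapes" "embedded s xs G" by blast
  show ?thesis
  proof (cases "G = map_graph ((!) xs) (coded s)")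
    case False
    obtain t ys where t: "t \<in> set (extensions s)" "embedded t ys G"
      using embedded_extension[OF s(2) _ assms(1,2) False] shapes_saves s(1) by blast
    from shapes_grow[OF s(1) t(1)] show ?thesis
    proof cases
      case (1 s' ps)
      then show ?thesis
        using saves_embedded embedded_trans[OF 1(2) t(2)] savers_saves assms by blast
    next
      case (2 s' ps)
      then have "s' \<in> ?S" using embedded_trans[OF 2(2) t(2)] shapes_saves by blast
      with max 2(3) show ?thesis by fastforce
    qed
  qed (use s in blast)
qed

subsection \<open>Trees\<close>

text \<open>Acyclicity is built into the construction, as every new vertex arrives with exactly one
  edge. The classification can then proceed by placing one leaf at a time.\<close>

inductive tree :: "'a ugraph \<Rightarrow> bool" where
  tree_single: "tree \<lparr>verts = {r}, edges = {}\<rparr>"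
| tree_leaf: "tree T \<Longrightarrow> w \<in> verts T \<Longrightarrow> x \<notin> verts T \<Longrightarrow> tree (add_leaf T w x)"

lemma tree_simple: "tree T \<Longrightarrow> simple_graph T"
  by (induction rule: tree.induct) (simp_all add: simple_graph_add_leaf, simp add: simple_graph_def)

lemma tree_connected: "tree T \<Longrightarrow> connected_graph T"
proof (induction rule: tree.induct)
  case (tree_single r)
  have "is_path \<lparr>verts = {r}, edges = {}\<rparr> [r]" by (simp add: is_path_Cons)
  then show ?case by (force simp: connected_graph_def)
next
  case (tree_leaf T w x)
  let ?T = "add_leaf T w x"
  have old: "\<exists>p. is_path ?T p \<and> hd p = a \<and> last p = b" if "a \<in> verts T" "b \<in> verts T" for a b
    using tree_leaf.IH that is_path_add_leaf unfolding connected_graph_def by metis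
  have new: "\<exists>p. is_path ?T p \<and> hd p = x \<and> last p = b" if "b \<in> verts T" for b
  proof -
    obtain p where p: "is_path T p" "hd p = w" "last p = b"
      using tree_leaf.IH tree_leaf.hyps(2) \<open>b \<in> verts T\<close> unfolding connected_graph_def by blast
    then have "p \<noteq> []" by auto
    then have "hd (x # p) = x" "last (x # p) = b" using p by auto
    then show ?thesis using is_path_leaf_Cons[OF p(1,2) tree_leaf.hyps(3)] by blast
  qed
  have single: "is_path ?T [x]" by (simp add: is_path_Cons)
  show ?case unfolding connected_graph_def
  proof (intro conjI ballI)
    fix a b assume "a \<in> verts ?T" "b \<in> verts ?T"
    then consider "a \<in> verts T" "b \<in> verts T" | "a = x" "b \<in> verts T" | "a \<in> verts T" "b = x"
      | "a = x" "b = x" by auto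
    then show "\<exists>p. is_path ?T p \<and> hd p = a \<and> last p = b"
    proof cases
      case 3
      then obtain p where p: "is_path ?T p" "hd p = x" "last p = a" using new by blast
      then have "p \<noteq> []" by auto
      with p 3 have "is_path ?T (rev p)" "hd (rev p) = a" "last (rev p) = b"
        by (simp_all add: is_path_rev hd_rev last_rev)
      then show ?thesis by blast
    next
      case 4
      have "hd [x] = a" "last [x] = b" using 4 by auto
      with single show ?thesis by blast
    qed (use old new in auto)
  qed simp
qed

text \<open>Inside \<open>G\<close> there are trees of every size up to the number of vertices: a
  tree that misses a vertex has an edge leaving it, whose outer end becomes a new leaf.\<close>

lemma spanning_tree:
  assumes "simple_graph G" "connected_graph G"
  obtains T where "tree T" "verts T = verts G" "edges T \<subseteq> edges G"
proof -
  have fin: "finite (verts G)" using assms(1) by (simp add: simple_graph_def)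
  have "Suc m \<le> card (verts G) \<Longrightarrow>
      \<exists>T. tree T \<and> verts T \<subseteq> verts G \<and> edges T \<subseteq> edges G \<and> card (verts T) = Suc m" for m
  proof (induction m)
    case 0
    obtain r where "r \<in> verts G" using assms(2) unfolding connected_graph_def by blast
    then show ?case by (intro exI[of _ "\<lparr>verts = {r}, edges = {}\<rparr>"]) (simp add: tree_single)
  next
    case (Suc m)
    then obtain T where T: "tree T" "verts T \<subseteq> verts G" "edges T \<subseteq> edges G" "card (verts T) = Suc m"
      by auto
    have "verts T \<noteq> {}" "verts T \<noteq> verts G" using T(4) Suc.prems by auto
    then obtain w x where "w \<in> verts T" "x \<in> verts G - verts T" "{w, x} \<in> edges G"
      using connected_graph_leaving_edge[OF assms(2) T(2)] by metis
    then show ?case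
      using T tree_leaf finite_subset[OF T(2) fin] by (intro exI[of _ "add_leaf T w x"]) auto
  qed
  moreover have "card (verts G) \<noteq> 0" using assms fin by (auto simp: connected_graph_def)
  ultimately obtain T where "tree T" "verts T \<subseteq> verts G" "edges T \<subseteq> edges G"
      "card (verts T) = card (verts G)"
    by (metis Suc_pred le_refl neq0_conv)
  then show thesis using that card_subset_eq[OF fin] by metis
qed

section \<open>Stars, double stars and the classification of trees\<close>

definition star :: "'a \<Rightarrow> 'a set \<Rightarrow> 'a ugraph" where
  "star u A = \<lparr>verts = insert u A, edges = (\<lambda>a. {u, a}) ` A\<rparr>"

text \<open>With the leaf sets as parameters, attaching a leaf to a center is an insertion, and
  exchanging the centers is a swap of arguments.\<close>

definition dstar :: "'a \<Rightarrow> 'a \<Rightarrow> 'a set \<Rightarrow> 'a set \<Rightarrow> 'a ugraph" where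
  "dstar u v A B = \<lparr>verts = {u, v} \<union> A \<union> B,
     edges = insert {u, v} ((\<lambda>a. {u, a}) ` A \<union> (\<lambda>b. {v, b}) ` B)\<rparr>"

text \<open>Both leaf sets are nonempty, since otherwise the graph would be a star.\<close>

definition dstar_parts :: "'a \<Rightarrow> 'a \<Rightarrow> 'a set \<Rightarrow> 'a set \<Rightarrow> bool" where
  "dstar_parts u v A B \<longleftrightarrow> u \<noteq> v \<and> {u, v} \<inter> (A \<union> B) = {} \<and> A \<inter> B = {} \<and>
     finite A \<and> finite B \<and> A \<noteq> {} \<and> B \<noteq> {}"

lemma dstar_commute: "dstar u v A B = dstar v u B A"
  by (auto simp: dstar_def insert_commute)

lemma dstar_parts_commute: "dstar_parts u v A B \<longleftrightarrow> dstar_parts v u B A"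
  by (auto simp: dstar_parts_def)

lemma add_leaf_star: "add_leaf (star u A) u x = star u (insert x A)"
  by (auto simp: add_leaf_def star_def)

lemma add_leaf_dstar: "add_leaf (dstar u v A B) u x = dstar u v (insert x A) B"
  by (auto simp: add_leaf_def dstar_def)

lemma add_leaf_commute: "add_leaf (add_leaf G w x) y z = add_leaf (add_leaf G y z) w x"
  by (auto simp: add_leaf_def)

lemma tree_star: "finite A \<Longrightarrow> u \<notin> A \<Longrightarrow> tree (star u A)"
proof (induction rule: finite_induct)
  case empty
  then show ?case using tree_single[of u] by (simp add: star_def)
next
  case (insert a A)
  then have "tree (add_leaf (star u A) u a)" by (intro tree_leaf) (auto simp: star_def)
  then show ?case by (simp add: add_leaf_star)
qed

lemma tree_dstar:
  assumes "dstar_parts u v A B" shows "tree (dstar u v A B)"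
proof -
  have "finite A" using assms by (simp add: dstar_parts_def)
  moreover have "finite B" "u \<notin> A" "v \<notin> A" "u \<notin> B" "v \<notin> B" "A \<inter> B = {}" "u \<noteq> v"
    using assms by (auto simp: dstar_parts_def)
  ultimately show ?thesis
  proof (induction rule: finite_induct)
    case empty
    have "dstar u v {} B = add_leaf (star v B) v u"
      by (auto simp: dstar_def star_def add_leaf_def)
    then show ?case using empty by (simp add: add_leaf_star tree_star)
  next
    case (insert a A)
    then have "tree (add_leaf (dstar u v A B) u a)" by (intro tree_leaf) (auto simp: dstar_def)
    then show ?case by (simp add: add_leaf_dstar)
  qed
qed

lemma saves_3I:
  assumes "tree T" "embedded s xs T" "s \<in> set savers" "card (verts T) \<ge> 2"
  shows "saves 3 T"
  using saves_embedded[OF _ assms(2) _ tree_simple[OF assms(1)] tree_connected[OF assms(1)] assms(4)]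
    savers_saves[OF assms(3)] by blast

text \<open>Induction over the attached leaves, with one case for each kind of vertex that can
  receive the new leaf. By the symmetry of the centers, the long leg of a \<open>T^1\<close> graph
  may always be placed at \<open>u\<close>.\<close>

lemma tree_classification:
  assumes "tree T"
  shows "(\<exists>u A. T = star u A \<and> finite A \<and> u \<notin> A) \<or>
    (\<exists>u v A B. T = dstar u v A B \<and> dstar_parts u v A B) \<or>
    (\<exists>u v A B w x. T = add_leaf (dstar u v A B) w x \<and> dstar_parts u v A B \<and> w \<in> A \<and>
       x \<notin> verts (dstar u v A B)) \<or>
    saves 3 T" (is "?star T \<or> ?dstar T \<or> ?dstar1 T \<or> _ T")
  using assms
proof (induction rule: tree.induct)
  case (tree_single r)
  have "\<lparr>verts = {r}, edges = {}\<rparr> = star r {}" by (simp add: star_def)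
  then show ?case by blast
next
  case (tree_leaf T p y)
  let ?T = "add_leaf T p y"
  have tree: "tree ?T" using tree_leaf.hyps by (rule tree.tree_leaf)
  have "finite (verts T)" using tree_simple tree_leaf.hyps(1) unfolding simple_graph_def by blast
  then have card: "card (verts ?T) \<ge> 2"
    using tree_leaf.hyps card_gt_0_iff[of "verts T"] by (auto simp: Suc_le_eq)
  have embI: "saves 3 ?T" if "embedded s xs ?T" "s \<in> set savers" for s xs
    using saves_3I[OF tree that card] .
  from tree_leaf.IH consider (star) "?star T" | (dstar) "?dstar T" | (dstar1) "?dstar1 T" | (saves) "saves 3 T"
    by blast
  then show ?case
  proof cases
    case star
    then obtain u A where T: "T = star u A" "finite A" "u \<notin> A" by blast
    have y: "y \<noteq> u" "y \<notin> A" using tree_leaf.hyps T by (auto simp: star_def)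
    consider "p = u" | "A = {p}" | a where "p \<in> A" "a \<in> A" "a \<noteq> p"
      using tree_leaf.hyps(2) T by (auto simp: star_def)
    then show ?thesis
    proof cases
      case 1
      then have "?T = star u (insert y A)" using T add_leaf_star by metis
      then show ?thesis using T y by blast
    next
      \<comment> \<open>Here the star is a single edge, and the new leaf makes its other end the
        center.\<close>
      case 2
      then have "?T = star p {u, y}" using T by (auto simp: star_def add_leaf_def insert_commute)
      moreover have "p \<notin> {u, y}" using T y 2 by auto
      ultimately show ?thesis by blast
    next
      case 3
      then have "?T = dstar u p (A - {p}) {y}" using T by (auto simp: star_def dstar_def add_leaf_def)
      moreover have "dstar_parts u p (A - {p}) {y}" using T y 3 by (auto simp: dstar_parts_def)
      ultimately show ?thesis by blast
    qed
  next
    case dstar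
    then obtain u v A B where T: "T = dstar u v A B" "dstar_parts u v A B" by blast
    have y: "y \<notin> verts (dstar u v A B)" using tree_leaf.hyps T by blast
    consider "p = u" | "p = v" | "p \<in> A" | "p \<in> B" using tree_leaf.hyps(2) T by (auto simp: dstar_def)
    then show ?thesis
    proof cases
      case 1
      then have "?T = dstar u v (insert y A) B" using T add_leaf_dstar by metis
      moreover have "dstar_parts u v (insert y A) B"
        using T y by (auto simp: dstar_parts_def dstar_def)
      ultimately show ?thesis by blast
    next
      case 2
      then have "?T = dstar v u (insert y B) A" using T add_leaf_dstar dstar_commute by metis
      moreover have "dstar_parts v u (insert y B) A"
        using T y by (auto simp: dstar_parts_def dstar_def)
      ultimately show ?thesis by blast
    next
      case 3
      then show ?thesis using T y by blast
    next
      case 4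
      then show ?thesis using T y dstar_commute dstar_parts_commute by metis
    qed
  next
    case dstar1
    then obtain u v A B w x where T: "T = add_leaf (dstar u v A B) w x" "dstar_parts u v A B"
      "w \<in> A" "x \<notin> verts (dstar u v A B)" by blast
    have parts: "u \<noteq> v" "u \<notin> A" "v \<notin> A" "u \<notin> B" "v \<notin> B" "A \<inter> B = {}" "finite A" "finite B"
      using T(2) by (auto simp: dstar_parts_def)
    have x: "x \<noteq> u" "x \<noteq> v" "x \<notin> A" "x \<notin> B" using T(4) by (auto simp: dstar_def)
    have y: "y \<noteq> u" "y \<noteq> v" "y \<notin> A" "y \<notin> B" "y \<noteq> x"
      using tree_leaf.hyps(3) T(1) by (auto simp: dstar_def)
    obtain b where b: "b \<in> B" using T(2) by (auto simp: dstar_parts_def)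
    have vT: "verts ?T = {u, v, x, y} \<union> A \<union> B" using T(1) by (auto simp: dstar_def)
    have eT: "edges ?T = {{p, y}, {w, x}, {u, v}} \<union> (\<lambda>a. {u, a}) ` A \<union> (\<lambda>b. {v, b}) ` B"
      using T(1) by (auto simp: dstar_def)
    have E: "{w, x} \<in> edges ?T" "{x, w} \<in> edges ?T" "{w, u} \<in> edges ?T" "{u, w} \<in> edges ?T"
      "{u, v} \<in> edges ?T" "{v, b} \<in> edges ?T" "{p, y} \<in> edges ?T" "{y, p} \<in> edges ?T"
      using b T(3) unfolding eT by (auto simp: insert_commute)
    have V: "{u, v, w, x, y, b, p} \<subseteq> verts ?T" using b T(3) tree_leaf.hyps(2) by (auto simp: vT[symmetric]) (auto simp: T dstar_def)
    have distinct: "distinct [u, v, w, x, y, b]" using parts x y b T(3) by auto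
    consider "p = u" | "p = v" | "p \<in> A - {w}" | "p = x" | "p \<in> B" | "p = w" "B = {b}"
      | b' where "p = w" "b' \<in> B" "b' \<noteq> b"
      using tree_leaf.hyps(2) T(1) b by (auto simp: dstar_def)
    then show ?thesis
    proof cases
      case 1
      then have "?T = add_leaf (dstar u v (insert y A) B) w x"
        using T(1) add_leaf_dstar add_leaf_commute by metis
      moreover have "dstar_parts u v (insert y A) B" "x \<notin> verts (dstar u v (insert y A) B)"
        using T x y by (auto simp: dstar_parts_def dstar_def)
      ultimately show ?thesis using T(3) by blast
    next
      case 2
      then have "?T = add_leaf (dstar u v A (insert y B)) w x"
        using T(1) add_leaf_dstar add_leaf_commute dstar_commute by metis
      moreover have "dstar_parts u v A (insert y B)" "x \<notin> verts (dstar u v A (insert y B))"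
        using T x y by (auto simp: dstar_parts_def dstar_def)
      ultimately show ?thesis using T(3) by blast
    next
      \<comment> \<open>A second leaf of \<open>u\<close> is extended, which gives the spider at
        \<open>u\<close> with legs \<open>w x\<close>, \<open>p y\<close> and
        \<open>v b\<close>.\<close>
      case 3
      then have "distinct [u, w, x, p, y, v, b]" using distinct parts x y b by auto
      moreover have "{u, p} \<in> edges ?T" using 3 unfolding eT by blast
      ultimately have "embedded (7, [(0, 1), (1, 2), (0, 3), (3, 4), (0, 5), (5, 6)]) [u, w, x, p, y, v, b] ?T"
        using V E by (simp add: embedded_def del: add_leaf_sel)
      then show ?thesis using embI by (simp add: savers_def)
    next
      case 4
      have "embedded (6, [(0, 1), (1, 2), (2, 3), (3, 4), (4, 5)]) [y, x, w, u, v, b] ?T"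
        using distinct V E 4 by (auto simp: embedded_def simp del: add_leaf_sel)
      then show ?thesis using embI by (simp add: savers_def)
    next
      case 5
      then have "distinct [x, w, u, v, p, y]" using distinct parts x y T(3) by auto
      moreover have "{v, p} \<in> edges ?T" using 5 unfolding eT by blast
      ultimately have "embedded (6, [(0, 1), (1, 2), (2, 3), (3, 4), (4, 5)]) [x, w, u, v, p, y] ?T"
        using V E by (simp add: embedded_def del: add_leaf_sel)
      then show ?thesis using embI by (simp add: savers_def)
    next
      \<comment> \<open>The roles change: \<open>u\<close> and \<open>w\<close> become the centers,
        \<open>x\<close> and \<open>y\<close> the leaves at \<open>w\<close>, and \<open>v b\<close>
        the long leg at \<open>u\<close>.\<close>
      case 6
      define A' where "A' = A - {w}"
      have A: "A = insert w A'" using T(3) by (auto simp: A'_def)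
      have "verts ?T = verts (add_leaf (dstar u w (insert v A') {x, y}) v b)"
        unfolding vT A 6(2) by (auto simp: dstar_def)
      moreover have "edges ?T = edges (add_leaf (dstar u w (insert v A') {x, y}) v b)"
        unfolding eT unfolding A 6 by (simp add: dstar_def insert_commute)
      ultimately have "?T = add_leaf (dstar u w (insert v A') {x, y}) v b" by simp
      moreover have "dstar_parts u w (insert v A') {x, y}"
        "b \<notin> verts (dstar u w (insert v A') {x, y})"
        using parts x y b T(3) by (auto simp: dstar_parts_def dstar_def A'_def)
      ultimately show ?thesis by blast
    next
      \<comment> \<open>Both neighbors \<open>w\<close> and \<open>v\<close> of \<open>u\<close> now
        have two leaves, so this is the double star whose center edge is subdivided by
        \<open>u\<close>.\<close>
      case 7
      then have "distinct [u, w, x, y, v, b, b']" using distinct parts x y b T(3) by auto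
      moreover have V': "b' \<in> verts ?T" using 7 unfolding vT by blast
      moreover have "{v, b'} \<in> edges ?T" using 7 unfolding eT by blast
      ultimately have "embedded (7, [(0, 1), (1, 2), (1, 3), (0, 4), (4, 5), (4, 6)]) [u, w, x, y, v, b, b'] ?T"
        using V V' E 7 by (simp add: embedded_def del: add_leaf_sel)
      then show ?thesis using embI by (simp add: savers_def)
    qed
  next
    case saves
    then show ?thesis
      using saves_add_leaf[OF _ tree_simple[OF tree_leaf.hyps(1)] tree_leaf.hyps(2,3)] by blast
  qed
qed

text \<open>An edge outside the spanning tree closes the tree path between its ends to a cycle. That
  path has at least three vertices because the edge is not in the tree.\<close>

lemma cycle_or_long_path:
  assumes "simple_graph G" "connected_graph G" "tree T" "verts T = verts G" "edges T \<subset> edges G"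
  obtains xs where "embedded (6, [(0, 1), (1, 2), (2, 3), (3, 4), (4, 5)]) xs G"
  | xs s where "s \<in> set shapes" "embedded s xs G"
proof -
  obtain e where "e \<in> edges G" "e \<notin> edges T" using assms(5) by blast
  then obtain x y where xy: "x \<in> verts G" "y \<in> verts G" "x \<noteq> y" "{x, y} \<in> edges G" "{x, y} \<notin> edges T"
    using simple_graph_edgeE[OF assms(1)] by metis
  then obtain p where p: "is_path T p" "hd p = x" "last p = y"
    using tree_connected[OF assms(3)] assms(4) unfolding connected_graph_def by metis
  have "is_path G p" using p(1) assms(4,5) is_path_mono[of T p G] by auto
  then have G: "p \<noteq> []" "distinct p" "set p \<subseteq> verts G"
    and step: "\<And>i. Suc i < length p \<Longrightarrow> {p ! i, p ! Suc i} \<in> edges G"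
    unfolding is_path_def by auto
  have ends: "p ! 0 = x" "p ! (length p - 1) = y" using p G(1) by (auto simp: hd_conv_nth last_conv_nth)
  have "length p \<noteq> 1" using ends xy by auto
  moreover have "length p \<noteq> 2"
  proof
    assume "length p = 2"
    then have "{p ! 0, p ! Suc 0} \<in> edges T" using p(1) unfolding is_path_def by auto
    with ends xy \<open>length p = 2\<close> show False by simp
  qed
  moreover have "length p \<noteq> 0" using G(1) by simp
  ultimately have "length p = 3 \<or> length p = 4 \<or> length p = 5 \<or> length p \<ge> 6" by linarith
  then consider "length p = 3" | "length p = 4" | "length p = 5" | "length p \<ge> 6" by blast
  then show thesis
  proof cases
    case 1
    then have "embedded (3, [(0, 1), (1, 2), (0, 2)]) p G"
      using G step[of 0] step[of 1] ends xy by (simp add: embedded_def numeral_2_eq_2)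
    then show thesis by (rule that(2)[rotated]) (simp add: shapes_def)
  next
    case 2
    then have "embedded (4, [(0, 1), (1, 2), (2, 3), (0, 3)]) p G"
      using G step[of 0] step[of 1] step[of 2] ends xy by (simp add: embedded_def eval_nat_numeral)
    then show thesis by (rule that(2)[rotated]) (simp add: shapes_def)
  next
    case 3
    then have "embedded (5, [(0, 1), (1, 2), (2, 3), (3, 4), (0, 4)]) p G"
      using G step[of 0] step[of 1] step[of 2] step[of 3] ends xy
      by (simp add: embedded_def eval_nat_numeral)
    then show thesis by (rule that(2)[rotated]) (simp add: shapes_def)
  next
    case 4
    \<comment> \<open>A cycle on six or more vertices is too long to be a shape, but the first six
      vertices of the path already form \<open>P_6\<close>.\<close>
    have "{take 6 p ! i, take 6 p ! Suc i} \<in> edges G" if "i < 5" for i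
      using step[of i] that 4 by simp
    then have "embedded (6, [(0, 1), (1, 2), (2, 3), (3, 4), (4, 5)]) (take 6 p) G"
      using G 4 set_take_subset[of 6 p] by (auto simp: embedded_def eval_nat_numeral)
    with that(1) show thesis .
  qed
qed

subsection \<open>Lower bounds\<close>

text \<open>Upper and lower bound are bundled, so that both transfer to isomorphic copies in one
  step; additions replace truncated subtraction.\<close>

definition tight :: "nat \<Rightarrow> 'a ugraph \<Rightarrow> bool" where
  "tight d G \<longleftrightarrow> saves d G \<and>
     (\<forall>c. pc12_coloring G c \<longrightarrow> card (verts G) \<le> card (c ` edges G) + d)"

lemma pc12_tight: "tight d G \<Longrightarrow> pc12 G = card (verts G) - d"
  unfolding tight_def by (rule pc12_eq) auto

lemma tight_map:
  assumes "simple_graph G" "inj_on f (verts G)" "tight d G"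
  shows "tight d (map_graph f G)"
  unfolding tight_def
proof (intro conjI allI impI)
  show "saves d (map_graph f G)" using saves_map assms unfolding tight_def by blast
  fix c assume "pc12_coloring (map_graph f G) c"
  then have "card (verts G) \<le> card (c ` edges (map_graph f G)) + d"
    using pc12_coloring_map[OF assms(1,2)] card_colors_map[of c f G] assms(3)
    unfolding tight_def by metis
  then show "card (verts (map_graph f G)) \<le> card (c ` edges (map_graph f G)) + d"
    using assms(2) by (simp add: card_image)
qed

lemma graph_iso_tight:
  assumes "graph_iso G H" "simple_graph G" "simple_graph H" "tight d H"
  shows "pc12 G = card (verts G) - d"
proof -
  obtain f where "inj_on f (verts H)" "G = map_graph f H" using graph_isoE[OF assms(1-3)] .
  then show ?thesis using pc12_tight tight_map assms(3,4) by blast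
qed

lemma coded_edge_saves: "saves 1 (coded (2, [(0, 1)]))" "valid_code (2, [(0, 1)])"
proof -
  have "saving_check 1 (2, [(0, 1)]) [0]" by code_simp
  then show "saves 1 (coded (2, [(0, 1)]))" "valid_code (2, [(0, 1)])"
    using saves_coded saving_check_def by blast+
qed

text \<open>The first and the last of the four edges have two edges between them, so they may share
  a color. This is the saving of two in every \<open>T^1\<close> graph.\<close>

lemma coded_path5_saves:
  "saves 2 (coded (5, [(0, 1), (1, 2), (2, 3), (3, 4)]))"
  "valid_code (5, [(0, 1), (1, 2), (2, 3), (3, 4)])"
proof -
  have "saving_check 2 (5, [(0, 1), (1, 2), (2, 3), (3, 4)]) [0, 1, 2, 0]" by code_simp
  then show "saves 2 (coded (5, [(0, 1), (1, 2), (2, 3), (3, 4)]))"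
    "valid_code (5, [(0, 1), (1, 2), (2, 3), (3, 4)])"
    using saves_coded saving_check_def by blast+
qed

text \<open>A single edge has two vertices and one color; growing it preserves this saving of
  one.\<close>

lemma tree_saves_1:
  assumes "tree T" "card (verts T) \<ge> 2" shows "saves 1 T"
proof -
  obtain w where "w \<in> verts T" using assms(2) by fastforce
  have "{w} \<noteq> verts T"
  proof
    assume "{w} = verts T"
    then have "card (verts T) = card {w}" by simp
    with assms(2) show False by simp
  qed
  with \<open>w \<in> verts T\<close> obtain x where "x \<in> verts T - {w}" "{w, x} \<in> edges T"
    using connected_graph_leaving_edge[OF tree_connected[OF assms(1)], of "{w}"] by blast
  with \<open>w \<in> verts T\<close> have "embedded (2, [(0, 1)]) [w, x] T" by (auto simp: embedded_def)
  then show ?thesis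
    using saves_embedded[OF coded_edge_saves(1) _ coded_edge_saves(2)] tree_simple tree_connected assms
    by blast
qed

section \<open>Lower bounds for stars, double stars and \<open>T^1\<close> graphs\<close>

lemma path_leaf_start:
  assumes "is_path G p" "hd p \<noteq> last p" "\<And>y. {hd p, y} \<in> edges G \<Longrightarrow> y = u"
  obtains q where "p = hd p # u # q"
proof (cases p)
  case (Cons a p')
  with assms(2) obtain b q where "p' = b # q" by (cases p') auto
  with Cons assms that show thesis by (auto simp: is_path_Cons)
qed (use assms in auto)

lemma path_leaf_end:
  assumes "is_path G (u # z # p)" "\<And>y. {z, y} \<in> edges G \<Longrightarrow> y = u"
  shows "p = []"
  using assms by (cases p) (auto simp: is_path_Cons)

lemma star_edge_iff: "{x, y} \<in> edges (star u A) \<longleftrightarrow> x = u \<and> y \<in> A \<or> y = u \<and> x \<in> A"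
  by (auto simp: star_def doubleton_eq_iff)

lemma star_path:
  assumes "is_path (star u A) p" "hd p = a" "last p = b" "a \<in> A" "b \<in> A" "a \<noteq> b" "u \<notin> A"
  shows "p = [a, u, b]"
proof -
  have leaf: "{z, y} \<in> edges (star u A) \<Longrightarrow> y = u" if "z \<in> A" for z y
    using that assms(7) by (auto simp: star_edge_iff)
  obtain q where q: "p = a # u # q" using path_leaf_start[OF assms(1), of u] assms leaf by metis
  with assms(3,5,7) obtain z r where z: "q = z # r" by (cases q) auto
  with q assms have "z \<in> A" by (auto simp: is_path_Cons star_edge_iff)
  then have "r = []" using path_leaf_end[of "star u A" u z r] leaf assms(1) q z
    by (auto simp: is_path_Cons)
  with q z assms show ?thesis by auto
qed

text \<open>Two leaves are joined only through the center, so their edges must differ in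
  color.\<close>

lemma tight_star:
  assumes "finite A" "u \<notin> A" "A \<noteq> {}" shows "tight 1 (star u A)"
  unfolding tight_def
proof (intro conjI allI impI)
  have card: "card (verts (star u A)) = Suc (card A)" using assms by (simp add: star_def)
  have "card A \<noteq> 0" using assms by simp
  then show "saves 1 (star u A)" using tree_saves_1[OF tree_star[OF assms(1,2)]] card by simp
  fix c assume c: "pc12_coloring (star u A) c"
  have "c {u, a} \<noteq> c {u, b}" if ab: "a \<in> A" "b \<in> A" "a \<noteq> b" for a b
  proof -
    have "a \<in> verts (star u A)" "b \<in> verts (star u A)" using ab by (auto simp: star_def)
    then obtain p where p: "is_path (star u A) p" "hd p = a" "last p = b" "dist2_proper c p"
      using c ab(3) unfolding pc12_coloring_def by blast
    have "p = [a, u, b]" using star_path[OF p(1-3) ab assms(2)] .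
    with p(4) show ?thesis by (simp add: dist2_proper_spaced insert_commute)
  qed
  then have "inj_on (\<lambda>a. c {u, a}) A" by (meson inj_onI)
  then have "card ((\<lambda>a. c {u, a}) ` A) = card A" by (rule card_image)
  then show "card (verts (star u A)) \<le> card (c ` edges (star u A)) + 1"
    using card by (simp add: star_def image_image)
qed

lemma dstar_edge_iff: "{x, y} \<in> edges (dstar u v A B) \<longleftrightarrow> x = u \<and> y \<in> insert v A \<or>
    y = u \<and> x \<in> insert v A \<or> x = v \<and> y \<in> B \<or> y = v \<and> x \<in> B"
  by (simp add: dstar_def image_iff doubleton_eq_iff) blast

lemma dstar_path:
  assumes "is_path (dstar u v A B) p" "hd p = a" "last p = b" "a \<in> A" "b \<in> A \<union> B" "a \<noteq> b"
    "dstar_parts u v A B"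
  shows "p = (if b \<in> A then [a, u, b] else [a, u, v, b])"
proof -
  let ?G = "dstar u v A B"
  have parts: "u \<noteq> v" "u \<notin> A" "v \<notin> A" "u \<notin> B" "v \<notin> B" "A \<inter> B = {}"
    using assms(7) by (auto simp: dstar_parts_def)
  have leafA: "{z, y} \<in> edges ?G \<Longrightarrow> y = u" if "z \<in> A" for z y
    using that parts by (auto simp: dstar_edge_iff)
  have leafB: "{z, y} \<in> edges ?G \<Longrightarrow> y = v" if "z \<in> B" for z y
    using that parts by (auto simp: dstar_edge_iff)
  obtain q where q: "p = a # u # q" using path_leaf_start[OF assms(1), of u] assms leafA by metis
  with assms(3,5) parts obtain z r where z: "q = z # r" by (cases q) auto
  have "z \<in> insert v A" using assms(1) parts q z by (auto simp: is_path_Cons dstar_edge_iff)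
  then consider "z \<in> A" | "z = v" by blast
  then show ?thesis
  proof cases
    case 1
    have "is_path ?G (u # z # r)" using assms(1) q z by (simp add: is_path_Cons)
    then have "r = []" by (rule path_leaf_end) (rule leafA[OF 1])
    with q z 1 assms show ?thesis by auto
  next
    case 2
    with q z assms(3,5) parts obtain t r' where r: "r = t # r'" by (cases r) auto
    have "t \<in> B" using assms(1) parts q z r 2 by (auto simp: is_path_Cons dstar_edge_iff)
    have "is_path ?G (v # t # r')" using assms(1) q z r 2 by (simp add: is_path_Cons)
    then have "r' = []" by (rule path_leaf_end) (rule leafB[OF \<open>t \<in> B\<close>])
    with q z r 2 assms \<open>t \<in> B\<close> parts show ?thesis by auto
  qed
qed

lemma dstar_colors:
  assumes "pc12_coloring (dstar u v A B) c" "dstar_parts u v A B" "a \<in> A" "b \<in> A \<union> B" "a \<noteq> b"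
  shows "b \<in> A \<Longrightarrow> c {u, a} \<noteq> c {u, b}"
    "b \<in> B \<Longrightarrow> c {u, a} \<noteq> c {u, v} \<and> c {u, a} \<noteq> c {v, b} \<and> c {u, v} \<noteq> c {v, b}"
proof -
  have "a \<in> verts (dstar u v A B)" "b \<in> verts (dstar u v A B)" using assms by (auto simp: dstar_def)
  then obtain p where p: "is_path (dstar u v A B) p" "hd p = a" "last p = b" "dist2_proper c p"
    using assms(1,5) unfolding pc12_coloring_def by blast
  note * = dstar_path[OF p(1-3) assms(3-5) assms(2)]
  have "A \<inter> B = {}" using assms(2) by (simp add: dstar_parts_def)
  then have "b \<in> A \<Longrightarrow> p = [a, u, b]" "b \<in> B \<Longrightarrow> p = [a, u, v, b]" using * by auto
  with p(4) show "b \<in> A \<Longrightarrow> c {u, a} \<noteq> c {u, b}"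
    "b \<in> B \<Longrightarrow> c {u, a} \<noteq> c {u, v} \<and> c {u, a} \<noteq> c {v, b} \<and> c {u, v} \<noteq> c {v, b}"
    by (auto simp: dist2_proper_spaced insert_commute)
qed

lemma card_verts_dstar: "dstar_parts u v A B \<Longrightarrow> card (verts (dstar u v A B)) = card A + card B + 2"
  by (auto simp: dstar_parts_def dstar_def card_Un_disjoint)

text \<open>Any two edges lie on a path between two leaves that has at most three edges. This path
  is the only one between its ends, so all edges receive different colors.\<close>

lemma tight_dstar:
  assumes "dstar_parts u v A B" shows "tight 1 (dstar u v A B)"
  unfolding tight_def
proof (intro conjI allI impI)
  show "saves 1 (dstar u v A B)"
    using tree_saves_1[OF tree_dstar[OF assms]] card_verts_dstar[OF assms] by simp
  fix c assume c: "pc12_coloring (dstar u v A B) c"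
  have c': "pc12_coloring (dstar v u B A) c" using c by (metis dstar_commute)
  have parts': "dstar_parts v u B A" using assms by (rule dstar_parts_commute[THEN iffD1])
  \<comment> \<open>To separate the center edge from a leaf edge on one side, a path to some leaf on
    the other side is needed; \<open>a0\<close> and \<open>b0\<close> supply it.\<close>
  obtain a0 b0 where ab0: "a0 \<in> A" "b0 \<in> B" using assms by (auto simp: dstar_parts_def)
  have fin: "finite A" "finite B" and disj: "A \<inter> B = {}" using assms by (auto simp: dstar_parts_def)
  let ?f = "\<lambda>a. c {u, a}" and ?g = "\<lambda>b. c {v, b}"
  have "inj_on ?f A" using dstar_colors(1)[OF c assms] by (meson UnI1 inj_onI)
  moreover have "inj_on ?g B" using dstar_colors(1)[OF c' parts'] by (meson UnI1 inj_onI)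
  moreover have cross: "?f a \<noteq> c {u, v} \<and> ?f a \<noteq> ?g b \<and> c {u, v} \<noteq> ?g b" if "a \<in> A" "b \<in> B" for a b
    using dstar_colors(2)[OF c assms] that disj by blast
  have "?f ` A \<inter> ?g ` B = {}" using cross by blast
  moreover have "c {u, v} \<notin> ?f ` A"
  proof
    assume "c {u, v} \<in> ?f ` A"
    then obtain a where "a \<in> A" "c {u, v} = ?f a" unfolding image_iff by blast
    with cross[OF _ ab0(2), of a] show False by simp
  qed
  moreover have "c {u, v} \<notin> ?g ` B"
  proof
    assume "c {u, v} \<in> ?g ` B"
    then obtain b where "b \<in> B" "c {u, v} = ?g b" unfolding image_iff by blast
    with cross[OF ab0(1), of b] show False by simp
  qed
  moreover have "c ` edges (dstar u v A B) = insert (c {u, v}) (?f ` A \<union> ?g ` B)"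
    by (auto simp: dstar_def image_Un image_image)
  ultimately have "card (c ` edges (dstar u v A B)) = Suc (card A + card B)"
    using fin by (simp add: card_Un_disjoint card_image)
  then show "card (verts (dstar u v A B)) \<le> card (c ` edges (dstar u v A B)) + 1"
    using card_verts_dstar[OF assms] by simp
qed

text \<open>An inner vertex of a path has two different neighbors on it, whereas \<open>x\<close> is
  adjacent to \<open>w\<close> only.\<close>

lemma is_path_remove_leaf:
  assumes "simple_graph G" "x \<notin> verts G" "is_path (add_leaf G w x) p" "hd p \<noteq> x" "last p \<noteq> x"
  shows "is_path G p"
proof -
  have p: "p \<noteq> []" "distinct p" "set p \<subseteq> insert x (verts G)"
    "\<And>i. Suc i < length p \<Longrightarrow> {p ! i, p ! Suc i} \<in> insert {w, x} (edges G)"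
    using assms(3) unfolding is_path_def by auto
  have x: "e = {w, x}" if "e \<in> insert {w, x} (edges G)" "x \<in> e" for e
    using that assms(1,2) unfolding simple_graph_def by auto
  have "x \<notin> set p"
  proof
    assume "x \<in> set p"
    then obtain i where i: "i < length p" "p ! i = x" by (auto simp: in_set_conv_nth)
    have "p ! 0 \<noteq> x" "p ! (length p - 1) \<noteq> x"
      using assms(4,5) p(1) by (simp_all add: hd_conv_nth last_conv_nth)
    then have "i \<noteq> 0" "i \<noteq> length p - 1" using i(2) by metis+
    then obtain j where j: "i = Suc j" "Suc i < length p" using i by (cases i) auto
    have "{p ! j, x} = {w, x}" using x[OF p(4)[of j]] i j by auto
    moreover have "{x, p ! Suc i} = {w, x}" using x[OF p(4)[of i]] i j by auto
    moreover have "p ! j \<noteq> p ! i" "p ! Suc i \<noteq> p ! i" "p ! j \<noteq> p ! Suc i"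
      using i(1) j by (simp_all add: nth_eq_iff_index_eq[OF p(2)])
    ultimately show False unfolding i(2) doubleton_eq_iff by metis
  qed
  moreover have "{p ! i, p ! Suc i} \<in> edges G" if "Suc i < length p" for i
  proof -
    have "x \<notin> {p ! i, p ! Suc i}" using \<open>x \<notin> set p\<close> that
      by (metis Suc_lessD empty_iff insertE nth_mem)
    then show ?thesis using p(4)[OF that] by blast
  qed
  ultimately show ?thesis using p unfolding is_path_def by blast
qed

lemma pc12_coloring_remove_leaf:
  assumes "simple_graph G" "x \<notin> verts G" "pc12_coloring (add_leaf G w x) c"
  shows "pc12_coloring G c"
  unfolding pc12_coloring_def
proof (intro ballI impI)
  fix a b assume ab: "a \<in> verts G" "b \<in> verts G" "a \<noteq> b"
  then obtain p where p: "is_path (add_leaf G w x) p" "hd p = a" "last p = b" "dist2_proper c p"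
    using assms(3) unfolding pc12_coloring_def by (metis add_leaf_sel(1) insertI2)
  then have "is_path G p" using is_path_remove_leaf[OF assms(1,2)] ab assms(2) by blast
  with p show "\<exists>p. is_path G p \<and> hd p = a \<and> last p = b \<and> dist2_proper c p" by blast
qed

text \<open>The path \<open>x\<close>, \<open>w\<close>, \<open>u\<close>, \<open>v\<close>,
  \<open>b\<close> on five vertices gives the saving of two. Conversely, without the leaf
  \<open>x\<close> a coloring is still valid on the double star, which needs one color less than it
  has vertices.\<close>

lemma tight_dstar1:
  assumes "dstar_parts u v A B" "w \<in> A" "x \<notin> verts (dstar u v A B)"
  shows "tight 2 (add_leaf (dstar u v A B) w x)"
  unfolding tight_def
proof (intro conjI allI impI)
  let ?G = "dstar u v A B"
  have G: "tree ?G" by (rule tree_dstar[OF assms(1)])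
  have T: "tree (add_leaf ?G w x)"
    using tree_leaf[OF G] assms by (simp add: dstar_def)
  have fin: "finite (verts ?G)" "finite (edges ?G)"
    using tree_simple[OF G] finite_edges by (auto simp: simple_graph_def)
  have card: "card (verts (add_leaf ?G w x)) = card (verts ?G) + 1"
    using assms(3) fin by simp
  obtain b where b: "b \<in> B" using assms(1) by (auto simp: dstar_parts_def)
  have "embedded (5, [(0, 1), (1, 2), (2, 3), (3, 4)]) [x, w, u, v, b] (add_leaf ?G w x)"
    using assms b by (auto simp: embedded_def dstar_def dstar_parts_def insert_commute)
  then show "saves 2 (add_leaf ?G w x)"
    using saves_embedded[OF coded_path5_saves(1) _ coded_path5_saves(2) tree_simple[OF T] tree_connected[OF T]]
      card card_verts_dstar[OF assms(1)] by simp
  fix c assume "pc12_coloring (add_leaf ?G w x) c"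
  then have "pc12_coloring ?G c"
    by (rule pc12_coloring_remove_leaf[OF tree_simple[OF G] assms(3)])
  then have "card (verts ?G) \<le> card (c ` edges ?G) + 1"
    using tight_dstar[OF assms(1)] by (simp add: tight_def)
  also have "card (c ` edges ?G) \<le> card (c ` edges (add_leaf ?G w x))"
    using fin by (intro card_mono) auto
  finally show "card (verts (add_leaf ?G w x)) \<le> card (c ` edges (add_leaf ?G w x)) + 2"
    using card by simp
qed

section \<open>Lower bounds for the cycles and the listed graphs\<close>

lemma spaced_card:
  assumes "spaced xs" "n \<le> 3" "n \<le> length xs" shows "n \<le> card (set xs)"
proof -
  have "n = 0 \<or> n = 1 \<or> n = 2 \<or> n = 3" using assms(2) by linarith
  \<comment> \<open>The first three entries are pairwise at distance at most two, hence pairwise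
    different.\<close>
  then have "distinct (take n xs)"
  proof (cases xs rule: spaced.cases)
    case (1 a b c ys)
    then have "spaced (b # c # ys)" "a \<noteq> b" "a \<noteq> c" using assms(1) by auto
    moreover from this have "b \<noteq> c" by (cases ys) auto
    ultimately show ?thesis using 1 \<open>n = 0 \<or> n = 1 \<or> n = 2 \<or> n = 3\<close> by auto
  qed (use assms(1) in \<open>auto simp: take_Cons'\<close>)
  then have "card (set (take n xs)) = n" using assms(3) by (simp add: distinct_card)
  then show ?thesis by (metis List.finite_set card_mono set_take_subset)
qed

lemma coded_path:
  assumes "pc12_coloring (coded (k, es)) c" "x < k" "y < k" "x \<noteq> y"
  obtains p where "p \<in> set (paths_from k es k [] x)" "last p = y" "spaced (map c (path_edges p))"
    "set (path_edges p) \<subseteq> edges (coded (k, es))"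
proof -
  obtain p where p: "is_path (coded (k, es)) p" "hd p = x" "last p = y" "dist2_proper c p"
    using assms unfolding pc12_coloring_def by (metis coded_sel(1) lessThan_iff)
  then have "distinct p" "set p \<subseteq> {..<k}" by (auto simp: is_path_def)
  then have "length p \<le> Suc k"
    by (metis card_lessThan card_mono distinct_card finite_lessThan le_Suc_eq)
  then have "p \<in> set (paths_from k es k [] x)" using paths_from_complete[OF p(1,2)] by simp
  with p that path_edges_subset dist2_proper_spaced show thesis by blast
qed

text \<open>The bound \<open>n \<le> 3\<close> is needed because only three consecutive edges of a path must have distinct colors.\<close>

definition route_check :: "nat \<times> (nat \<times> nat) list \<Rightarrow> nat \<Rightarrow> nat \<Rightarrow> nat \<Rightarrow> nat list list \<Rightarrow> bool" where
  "route_check = (\<lambda>(k, es) n x y ps. x < k \<and> y < k \<and> x \<noteq> y \<and>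
     list_all (\<lambda>p. last p = y \<longrightarrow> p \<in> set ps \<or> n \<le> 3 \<and> n < length p) (paths_from k es k [] x))"

text \<open>A proper path with at least \<open>n\<close> edges forces \<open>n\<close> colors when
  \<open>n \<le> 3\<close>. The routes in \<open>ps\<close> are exempt and remain as alternatives;
  an empty \<open>ps\<close> gives the bound outright.\<close>

lemma route_colors:
  assumes "pc12_coloring (coded s) c" "route_check s n x y ps"
  shows "n \<le> card (c ` edges (coded s)) \<and> n \<le> 3 \<or> (\<exists>p\<in>set ps. spaced (map c (path_edges p)))"
proof -
  obtain k es where s: "s = (k, es)" by (cases s)
  note check = assms(2)[unfolded route_check_def s prod.case list_all_iff]
  obtain p where p: "p \<in> set (paths_from k es k [] x)" "last p = y" "spaced (map c (path_edges p))"
    "set (path_edges p) \<subseteq> edges (coded (k, es))"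
    using coded_path[of k es c x y] assms(1) check unfolding s by blast
  show ?thesis
  proof (cases "p \<in> set ps")
    case False
    then have n: "n \<le> 3" "n < length p" using check p by blast+
    then have "n \<le> card (set (map c (path_edges p)))"
      using spaced_card[OF p(3), of n] by (simp add: path_edges_def)
    also have "\<dots> \<le> card (c ` edges (coded s))"
      using p(4) unfolding s by (intro card_mono) auto
    finally show ?thesis using n by blast
  qed (use p in blast)
qed

lemma card_colors_ge3:
  assumes "finite E" "{e1, e2, e3} \<subseteq> E" "c e1 \<noteq> c e2" "c e1 \<noteq> c e3" "c e2 \<noteq> c e3"
  shows "3 \<le> card (c ` E)"
proof -
  have "card {c e1, c e2, c e3} = 3" using assms by simp
  moreover have "{c e1, c e2, c e3} \<subseteq> c ` E" using assms by auto
  ultimately show ?thesis using assms(1) by (metis card_mono finite_imageI)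
qed


text \<open>Vertices at distance two are joined by arcs of two and of three edges, and the longer
  arc uses three colors. With fewer colors the short arcs must all be proper, which would be a
  proper 2-coloring of the edges of an odd cycle.\<close>

lemma cycle5_colors:
  assumes "pc12_coloring (coded (5, [(0, 1), (1, 2), (2, 3), (3, 4), (0, 4)])) c"
  shows "3 \<le> card (c ` edges (coded (5, [(0, 1), (1, 2), (2, 3), (3, 4), (0, 4)])))"
proof (rule ccontr)
  let ?s = "(5, [(0, 1), (1, 2), (2, 3), (3, 4), (0, 4)]) :: nat \<times> (nat \<times> nat) list"
  assume *: "\<not> 3 \<le> card (c ` edges (coded ?s))"
  have "route_check ?s 3 0 2 [[0, 1, 2]]" "route_check ?s 3 1 3 [[1, 2, 3]]"
    "route_check ?s 3 2 4 [[2, 3, 4]]" "route_check ?s 3 3 0 [[3, 4, 0]]"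
    "route_check ?s 3 4 1 [[4, 0, 1]]"
    by code_simp+
  from this[THEN route_colors[OF assms]] *
  have ne: "c {0, 1} \<noteq> c {1, 2}" "c {1, 2} \<noteq> c {2, 3}" "c {2, 3} \<noteq> c {3, 4}" "c {3, 4} \<noteq> c {4, 0}"
    "c {4, 0} \<noteq> c {0, 1}"
    by (simp_all del: coded_sel)
  \<comment> \<open>With at most two colors, edges at distance two along the cycle agree. So
    \<open>{0, 1}\<close>, \<open>{2, 3}\<close> and \<open>{4, 0}\<close> have one color, although
    the first and the last are adjacent.\<close>
  have "c e1 = c e2 \<or> c e1 = c e3 \<or> c e2 = c e3" if "{e1, e2, e3} \<subseteq> edges (coded ?s)" for e1 e2 e3
    using card_colors_ge3[of "edges (coded ?s)" e1 e2 e3 c] that * by auto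
  from this[of "{0, 1}" "{1, 2}" "{2, 3}"] this[of "{1, 2}" "{2, 3}" "{3, 4}"]
    this[of "{2, 3}" "{3, 4}" "{4, 0}"] this[of "{0, 1}" "{1, 2}" "{4, 0}"] ne
  show False by (simp add: doubleton_eq_iff)
qed

text \<open>The detour around the triangle from a leaf to \<open>1\<close> has three edges and so
  uses three colors. Without it, the direct routes make both pendant edges and \<open>{0, 1}\<close>
  pairwise different.\<close>

lemma triangle_two_leaves_colors:
  assumes "pc12_coloring (coded (5, [(0, 1), (1, 2), (0, 2), (0, 3), (0, 4)])) c"
  shows "3 \<le> card (c ` edges (coded (5, [(0, 1), (1, 2), (0, 2), (0, 3), (0, 4)])))"
proof (rule ccontr)
  let ?s = "(5, [(0, 1), (1, 2), (0, 2), (0, 3), (0, 4)]) :: nat \<times> (nat \<times> nat) list"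
  assume *: "\<not> 3 \<le> card (c ` edges (coded ?s))"
  have "route_check ?s 3 3 4 [[3, 0, 4]]" "route_check ?s 3 3 1 [[3, 0, 1]]"
    "route_check ?s 3 4 1 [[4, 0, 1]]"
    by code_simp+
  from this[THEN route_colors[OF assms]] *
  have "c {3, 0} \<noteq> c {0, 4}" "c {3, 0} \<noteq> c {0, 1}" "c {4, 0} \<noteq> c {0, 1}"
    by (simp_all del: coded_sel)
  then have ne: "c {0, 3} \<noteq> c {0, 4}" "c {0, 3} \<noteq> c {0, 1}" "c {0, 4} \<noteq> c {0, 1}"
    by (simp_all add: insert_commute)
  show False
    using card_colors_ge3[of "edges (coded ?s)" "{0, 3}" "{0, 4}" "{0, 1}" c] ne * by simp
qed

text \<open>With three colors, the edges \<open>{2, 5}\<close>, \<open>{3, 5}\<close> and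
  \<open>{4, 5}\<close> use all of them. Vertex \<open>0\<close> cannot be reached directly from
  both leaves \<open>2\<close> and \<open>3\<close>, nor by the detour from both. So
  \<open>{0, 4}\<close> and \<open>{1, 4}\<close> take the two pendant colors, and
  \<open>{0, 1}\<close> has the color of \<open>{0, 4}\<close>. By symmetry, reaching
  \<open>1\<close> forces the color of \<open>{1, 4}\<close> on \<open>{0, 1}\<close>, a
  contradiction.\<close>

lemma double_star_edge_colors:
  assumes "pc12_coloring (coded (6, [(0, 4), (1, 4), (0, 1), (4, 5), (2, 5), (3, 5)])) c"
  shows "4 \<le> card (c ` edges (coded (6, [(0, 4), (1, 4), (0, 1), (4, 5), (2, 5), (3, 5)])))"
proof (rule ccontr)
  let ?s = "(6, [(0, 4), (1, 4), (0, 1), (4, 5), (2, 5), (3, 5)]) :: nat \<times> (nat \<times> nat) list"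
  let ?C = "c ` edges (coded ?s)"
  assume *: "\<not> 4 \<le> card ?C"
  \<comment> \<open>As \<open>4\<close> exceeds the admissible bound of three, no path is excused by
    its length, and the lists must contain all routes.\<close>
  have "route_check ?s 4 2 3 [[2, 5, 3]]" "route_check ?s 4 2 4 [[2, 5, 4]]"
    "route_check ?s 4 3 4 [[3, 5, 4]]"
    "route_check ?s 4 2 0 [[2, 5, 4, 0], [2, 5, 4, 1, 0]]"
    "route_check ?s 4 2 1 [[2, 5, 4, 1], [2, 5, 4, 0, 1]]"
    "route_check ?s 4 3 0 [[3, 5, 4, 0], [3, 5, 4, 1, 0]]"
    "route_check ?s 4 3 1 [[3, 5, 4, 1], [3, 5, 4, 0, 1]]"
    by code_simp+
  note routes = this[THEN route_colors[OF assms]]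
  have ne: "c {2, 5} \<noteq> c {3, 5}" "c {2, 5} \<noteq> c {4, 5}" "c {3, 5} \<noteq> c {4, 5}"
    using routes(1-3) by (simp_all del: coded_sel add: insert_commute)
  have "card {c {2, 5}, c {3, 5}, c {4, 5}} = 3" using ne by simp
  moreover have "{c {2, 5}, c {3, 5}, c {4, 5}} \<subseteq> ?C" by (auto simp: doubleton_eq_iff)
  ultimately have C: "?C = {c {2, 5}, c {3, 5}, c {4, 5}}"
    using * by (intro card_seteq[symmetric]) auto
  have in_C: "c e \<in> {c {2, 5}, c {3, 5}, c {4, 5}}" if "e \<in> edges (coded ?s)" for e
    using imageI[OF that, of c] unfolding C .
  have "c {0, 4} \<in> {c {2, 5}, c {3, 5}, c {4, 5}}" "c {1, 4} \<in> {c {2, 5}, c {3, 5}, c {4, 5}}"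
    "c {0, 1} \<in> {c {2, 5}, c {3, 5}, c {4, 5}}"
    by (rule in_C; simp)+
  with ne routes(4-7) show False
    by (simp del: coded_sel add: insert_commute) metis
qed

text \<open>Eight of the eleven shapes have two vertices at distance at least the number of vertices
  minus two, and a path between these already needs enough colors. The three others are the graphs
  treated above.\<close>

lemma shapes_colors:
  assumes "s \<in> set shapes" "pc12_coloring (coded s) c"
  shows "fst s \<le> card (c ` edges (coded s)) + 2"
proof -
  have "list_all (\<lambda>s. s = (5, [(0, 1), (1, 2), (2, 3), (3, 4), (0, 4)]) \<or>
      s = (5, [(0, 1), (1, 2), (0, 2), (0, 3), (0, 4)]) \<or>
      s = (6, [(0, 4), (1, 4), (0, 1), (4, 5), (2, 5), (3, 5)]) \<or>
      list_ex (\<lambda>x. list_ex (\<lambda>y. route_check s (fst s - 2) x y []) [0..<fst s]) [0..<fst s]) shapes"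
    by code_simp
  with assms(1) consider "s = (5, [(0, 1), (1, 2), (2, 3), (3, 4), (0, 4)])"
    | "s = (5, [(0, 1), (1, 2), (0, 2), (0, 3), (0, 4)])"
    | "s = (6, [(0, 4), (1, 4), (0, 1), (4, 5), (2, 5), (3, 5)])"
    | x y where "route_check s (fst s - 2) x y []"
    unfolding list_all_iff list_ex_iff by blast
  then show ?thesis
  proof cases
    case 1
    then show ?thesis using cycle5_colors assms(2) by fastforce
  next
    case 2
    then show ?thesis using triangle_two_leaves_colors assms(2) by fastforce
  next
    case 3
    then show ?thesis using double_star_edge_colors assms(2) by fastforce
  next
    case (4 x y)
    then show ?thesis using route_colors[OF assms(2) 4] by (simp del: coded_sel) linarith
  qed
qed

lemma tight_shape: "s \<in> set shapes \<Longrightarrow> tight 2 (coded s)"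
  unfolding tight_def using shapes_saves[of s] shapes_colors[of s] by (cases s) simp

lemma coded_shapes:
  "coded ` set shapes = cycle_graph ` {3, 4, 5} \<union> set graph_list_L"
proof -
  have "map coded (drop 3 shapes) = graph_list_L"
    by (simp add: shapes_def graph_list_L_def coded_def lessThan_nat_numeral Let_def insert_commute lessThan_Suc)
  moreover have "map coded (take 3 shapes) = map cycle_graph [3, 4, 5]"
  proof -
    have c: "edges (cycle_graph n) = (\<lambda>i. {i, (i + 1) mod n}) ` {..<n}"
      "verts (cycle_graph n) = {..<n}" for n
      by (auto simp: cycle_graph_def)
    have "coded (3, [(0, 1), (1, 2), (0, 2)]) = cycle_graph 3"
      by (rule ugraph.equality) (simp_all add: c lessThan_nat_numeral lessThan_Suc insert_commute numeral_2_eq_2[symmetric])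
    moreover have "coded (4, [(0, 1), (1, 2), (2, 3), (0, 3)]) = cycle_graph 4"
      by (rule ugraph.equality) (simp_all add: c lessThan_nat_numeral lessThan_Suc insert_commute numeral_2_eq_2[symmetric])
    moreover have "coded (5, [(0, 1), (1, 2), (2, 3), (3, 4), (0, 4)]) = cycle_graph 5"
      by (rule ugraph.equality) (simp_all add: c lessThan_nat_numeral lessThan_Suc insert_commute numeral_2_eq_2[symmetric])
    ultimately show ?thesis by (simp add: shapes_def)
  qed
  ultimately have "map coded shapes = map cycle_graph [3, 4, 5] @ graph_list_L"
    by (metis append_take_drop_id map_append)
  then have "set (map coded shapes) = set (map cycle_graph [3, 4, 5] @ graph_list_L)" by simp
  then show ?thesis by simp
qed

subsection \<open>Isomorphisms with the named graphs\<close>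

lemma map_star: "map_graph f (star u A) = star (f u) (f ` A)"
  by (auto simp: map_graph_def star_def image_image)

lemma map_dstar: "map_graph f (dstar u v A B) = dstar (f u) (f v) (f ` A) (f ` B)"
  by (simp add: map_graph_def dstar_def image_Un image_image)

lemma map_add_leaf: "map_graph f (add_leaf G w x) = add_leaf (map_graph f G) (f w) (f x)"
  by (simp add: map_graph_def add_leaf_def)

lemma star_graph_eq: "n \<ge> 1 \<Longrightarrow> star_graph n = star 0 {1..<n}"
  by (auto simp: star_graph_def star_def)

lemma double_star_eq: "double_star n1 n2 = dstar 0 1 {2..<n1 + 2} {n1 + 2..<n1 + n2 + 2}"
  by (rule ugraph.equality) (auto simp: double_star_def dstar_def)

lemma dstar_parts_double_star:
  "n1 \<ge> 1 \<Longrightarrow> n2 \<ge> 1 \<Longrightarrow> dstar_parts (0 :: nat) 1 {2..<n1 + 2} {n1 + 2..<n1 + n2 + 2}"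
  by (auto simp: dstar_parts_def)

text \<open>The subdividing vertex \<open>w\<close> takes the place of \<open>x\<close> among the
  leaves at \<open>u\<close>, and \<open>x\<close> becomes a leaf at \<open>w\<close>.\<close>

lemma subdivide_dstar:
  assumes "x \<in> A" "dstar_parts u v A B"
  shows "subdivide_edge (dstar u v A B) {u, x} w = add_leaf (dstar u v (insert w (A - {x})) B) w x"
proof (rule ugraph.equality)
  have parts: "u \<noteq> v" "u \<notin> A" "v \<notin> A" "u \<notin> B" "v \<notin> B" "A \<inter> B = {}"
    using assms(2) by (auto simp: dstar_parts_def)
  show "verts (subdivide_edge (dstar u v A B) {u, x} w) = verts (add_leaf (dstar u v (insert w (A - {x})) B) w x)"
    using assms(1) by (auto simp: subdivide_edge_def dstar_def)
  have "edges (dstar u v A B) - {{u, x}} = edges (dstar u v (A - {x}) B)"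
  proof (intro equalityI subsetI)
    fix e assume "e \<in> edges (dstar u v A B) - {{u, x}}"
    then show "e \<in> edges (dstar u v (A - {x}) B)" by (auto simp: dstar_def)
  next
    fix e assume "e \<in> edges (dstar u v (A - {x}) B)"
    then show "e \<in> edges (dstar u v A B) - {{u, x}}"
      using parts assms(1) by (auto simp: dstar_def doubleton_eq_iff)
  qed
  moreover have "{{y, w} | y. y \<in> {u, x}} = {{u, w}, {w, x}}" by (auto simp: insert_commute)
  ultimately show "edges (subdivide_edge (dstar u v A B) {u, x} w) =
      edges (add_leaf (dstar u v (insert w (A - {x})) B) w x)"
    by (simp add: subdivide_edge_def dstar_def insert_commute)
qed simp

text \<open>Each center has a leaf besides the other center, so neither end of the center edge has
  degree one.\<close>

lemma double_star_pendent:
  assumes "n1 \<ge> 1" "n2 \<ge> 1"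
  shows "pendent_edge (double_star n1 n2) e \<longleftrightarrow>
    e \<in> edges (double_star n1 n2) \<and> e \<noteq> {0, 1}"
proof -
  let ?G = "double_star n1 n2"
  have fin: "finite (edges ?G)" unfolding double_star_eq by (simp add: dstar_def)
  have leaf1: "{e \<in> edges ?G. i \<in> e} = {{0, i}}" if "i \<in> {2..<n1 + 2}" for i
    using that unfolding double_star_eq by (auto simp: dstar_def)
  have leaf2: "{e \<in> edges ?G. i \<in> e} = {{1, i}}" if "i \<in> {n1 + 2..<n1 + n2 + 2}" for i
    using that unfolding double_star_eq by (auto simp: dstar_def)
  have "card {e \<in> edges ?G. i \<in> e} \<noteq> 1" if "i \<in> {0, 1}" for i
  proof
    assume "card {e \<in> edges ?G. i \<in> e} = 1"
    then obtain e where e: "{e \<in> edges ?G. i \<in> e} = {e}" by (auto simp: card_1_singleton_iff)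
    have "{0, 1} \<in> edges ?G" "{0, 2} \<in> edges ?G" "{1, n1 + 2} \<in> edges ?G"
      using assms by (auto simp: double_star_eq dstar_def)
    then have "{0, 1} \<in> {e \<in> edges ?G. i \<in> e}"
      "{0, 2} \<in> {e \<in> edges ?G. i \<in> e} \<or> {1, n1 + 2} \<in> {e \<in> edges ?G. i \<in> e}"
      using that by auto
    then have "{0, 1} = e" "{0, 2} = e \<or> {1, n1 + 2} = e" unfolding e by simp_all
    then have "{0, 2} = {0, 1 :: nat} \<or> {1, n1 + 2} = {0, 1 :: nat}" by metis
    then show False by (auto simp: doubleton_eq_iff)
  qed
  then have "\<not> pendent_edge ?G {0, 1}" by (auto simp: pendent_edge_def)
  moreover have "pendent_edge ?G e" if e: "e \<in> edges ?G" "e \<noteq> {0, 1}"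
  proof -
    have "e \<in> (\<lambda>i. {0, i}) ` {2..<n1 + 2} \<or> e \<in> (\<lambda>i. {1, i}) ` {n1 + 2..<n1 + n2 + 2}"
      using e unfolding double_star_eq dstar_def by simp
    then consider i where "i \<in> {2..<n1 + 2}" "e = {0, i}" | i where "i \<in> {n1 + 2..<n1 + n2 + 2}" "e = {1, i}"
      by blast
    then obtain i where "i \<in> e" "{e' \<in> edges ?G. i \<in> e'} = {e}"
    proof cases
      case (1 i)
      show thesis by (rule that[of i]) (use leaf1[OF 1(1)] 1(2) in simp_all)
    next
      case (2 i)
      show thesis by (rule that[of i]) (use leaf2[OF 2(1)] 2(2) in simp_all)
    qed
    then have "card {e' \<in> edges ?G. i \<in> e'} = 1" by simp
    with \<open>i \<in> e\<close> e(1) show ?thesis unfolding pendent_edge_def by blast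
  qed
  ultimately show ?thesis unfolding pendent_edge_def by blast
qed

lemma tight_double_star1:
  assumes "n1 \<ge> 1" "n2 \<ge> 1" "H \<in> double_star1 n1 n2"
  shows "simple_graph H \<and> tight 2 H"
proof -
  let ?A = "{2..<n1 + 2}" and ?B = "{n1 + 2..<n1 + n2 + 2}" and ?w = "n1 + n2 + 2"
  have parts: "dstar_parts 0 1 ?A ?B" using dstar_parts_double_star assms by blast
  then have parts': "dstar_parts 1 0 ?B ?A" by (rule dstar_parts_commute[THEN iffD1])
  obtain e where e: "H = subdivide_edge (double_star n1 n2) e ?w"
    "e \<in> edges (double_star n1 n2)" "e \<noteq> {0, 1}"
    using assms double_star_pendent[OF assms(1,2)] unfolding double_star1_def by blast
  have general: "simple_graph (add_leaf (dstar u v A B) w x) \<and> tight 2 (add_leaf (dstar u v A B) w x)"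
    if "dstar_parts u v A B" "w \<in> A" "x \<notin> verts (dstar u v A B)" for u v w x :: nat and A B
  proof -
    have "w \<in> verts (dstar u v A B)" using that(2) by (simp add: dstar_def)
    then show ?thesis
      using tight_dstar1[OF that] simple_graph_add_leaf[OF tree_simple[OF tree_dstar[OF that(1)]] _ that(3)]
      by blast
  qed
  have "e \<in> (\<lambda>i. {0, i}) ` ?A \<or> e \<in> (\<lambda>i. {1, i}) ` ?B"
    using e(2,3) unfolding double_star_eq dstar_def by simp
  then consider i where "i \<in> ?A" "e = {0, i}" | i where "i \<in> ?B" "e = {1, i}" by blast
  then show ?thesis
  proof cases
    case (1 i)
    have "H = add_leaf (dstar 0 1 (insert ?w (?A - {i})) ?B) ?w i"
      unfolding e(1) 1(2) double_star_eq by (rule subdivide_dstar[OF 1(1) parts])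
    moreover have "dstar_parts 0 1 (insert ?w (?A - {i})) ?B"
      "i \<notin> verts (dstar 0 1 (insert ?w (?A - {i})) ?B)"
      using parts 1(1) by (auto simp: dstar_parts_def dstar_def)
    ultimately show ?thesis using general by simp
  next
    case (2 i)
    have "H = add_leaf (dstar 1 0 (insert ?w (?B - {i})) ?A) ?w i"
      unfolding e(1) 2(2) double_star_eq dstar_commute[of 0] by (rule subdivide_dstar[OF 2(1) parts'])
    moreover have "dstar_parts 1 0 (insert ?w (?B - {i})) ?A"
      "i \<notin> verts (dstar 1 0 (insert ?w (?B - {i})) ?A)"
      using parts' 2(1) by (auto simp: dstar_parts_def dstar_def)
    ultimately show ?thesis using general by simp
  qed
qed

text \<open>The bijections between the leaf sets are glued together with the assignment of the
  centers.\<close>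

lemma bij_dstar:
  assumes "finite A" "finite A'" "card A = card A'" "finite B" "finite B'" "card B = card B'"
    and "u \<noteq> v" "{u, v} \<inter> (A \<union> B) = {}" "A \<inter> B = {}"
    and "u' \<noteq> v'" "{u', v'} \<inter> (A' \<union> B') = {}" "A' \<inter> B' = {}"
  obtains g where "g u = u'" "g v = v'" "g ` A = A'" "g ` B = B'" "inj_on g ({u, v} \<union> A \<union> B)"
proof -
  obtain f where f: "bij_betw f A A'" using finite_same_card_bij[OF assms(1-3)] by blast
  obtain h where h: "bij_betw h B B'" using finite_same_card_bij[OF assms(4-6)] by blast
  define g where "g x = (if x = u then u' else if x = v then v' else if x \<in> A then f x else h x)" for x
  have g: "g u = u'" "g v = v'" using assms(7) by (simp_all add: g_def)
  have "g ` A = f ` A" by (rule image_cong) (use assms(8) in \<open>auto simp: g_def\<close>)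
  moreover have "g ` B = h ` B" by (rule image_cong) (use assms(8,9) in \<open>auto simp: g_def\<close>)
  ultimately have AB: "g ` A = A'" "g ` B = B'" using f h by (simp_all add: bij_betw_def)
  have "inj_on g ({u, v} \<union> A \<union> B)"
  \<comment> \<open>Injectivity follows by counting: the image is the whole second vertex set, which
    has the same size.\<close>
  proof (rule eq_card_imp_inj_on)
    have "g ` ({u, v} \<union> A \<union> B) = {u', v'} \<union> A' \<union> B'"
      unfolding image_Un AB by (simp add: g)
    moreover have "card ({u', v'} \<union> A' \<union> B') = card ({u, v} \<union> A \<union> B)"
    proof -
      have "card (A \<union> B) = card (A' \<union> B')" using assms by (simp add: card_Un_disjoint)
      then show ?thesis using assms by simp
    qed
    ultimately show "card (g ` ({u, v} \<union> A \<union> B)) = card ({u, v} \<union> A \<union> B)" by simp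
  qed (use assms in simp)
  with g AB show thesis by (rule that)
qed

lemma star_iso:
  assumes "finite A" "u \<notin> A" shows "graph_iso (star u A) (star_graph (Suc (card A)))"
proof -
  obtain f where f: "bij_betw f {1..<Suc (card A)} A"
    using finite_same_card_bij[OF _ assms(1), of "{1..<Suc (card A)}"] by auto
  let ?g = "f(0 := u)"
  have img: "?g ` {1..<Suc (card A)} = A" using f by (auto simp: bij_betw_def)
  have "inj_on ?g {1..<Suc (card A)} = inj_on f {1..<Suc (card A)}" by (rule inj_on_cong) simp
  with f have "inj_on ?g {1..<Suc (card A)}" by (simp add: bij_betw_def)
  then have "inj_on ?g (verts (star 0 {1..<Suc (card A)}))"
    using img assms(2) by (simp add: star_def)
  moreover have "simple_graph (star 0 {1..<Suc (card A)})" by (intro tree_simple tree_star) auto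
  ultimately have "graph_iso (map_graph ?g (star 0 {1..<Suc (card A)})) (star 0 {1..<Suc (card A)})"
    by (intro graph_iso_map)
  then show ?thesis using img by (simp add: map_star star_graph_eq del: fun_upd_image)
qed

lemma dstar_iso:
  assumes "dstar_parts u v A B" shows "graph_iso (dstar u v A B) (double_star (card A) (card B))"
proof -
  let ?A = "{2..<card A + 2}" and ?B = "{card A + 2..<card A + card B + 2}"
  have A: "card A \<ge> 1" "card B \<ge> 1" using assms by (auto simp: dstar_parts_def Suc_le_eq card_gt_0_iff)
  obtain g where g: "g 0 = u" "g 1 = v" "g ` ?A = A" "g ` ?B = B" "inj_on g ({0, 1} \<union> ?A \<union> ?B)"
    by (rule bij_dstar[of ?A A ?B B 0 1 u v]) (use assms in \<open>auto simp: dstar_parts_def\<close>)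
  have "simple_graph (dstar 0 1 ?A ?B)"
    by (intro tree_simple tree_dstar dstar_parts_double_star A)
  moreover have "inj_on g (verts (dstar 0 1 ?A ?B))" using g(5) by (simp add: dstar_def)
  ultimately have "graph_iso (map_graph g (dstar 0 1 ?A ?B)) (dstar 0 1 ?A ?B)" by (rule graph_iso_map)
  then show ?thesis unfolding map_dstar g(1-4) double_star_eq .
qed

text \<open>All leaves at a center are alike, so the edge from \<open>0\<close> to leaf
  \<open>2\<close> can be chosen for the subdivision.\<close>

lemma dstar1_iso:
  assumes "dstar_parts u v A B" "w \<in> A" "x \<notin> verts (dstar u v A B)"
  obtains H where "H \<in> double_star1 (card A) (card B)" "graph_iso (add_leaf (dstar u v A B) w x) H"
proof -
  let ?A = "{2..<card A + 2}" and ?B = "{card A + 2..<card A + card B + 2}" and ?w = "card A + card B + 2"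
  let ?A' = "?A - {2}"
  have A: "card A \<ge> 1" "card B \<ge> 1" using assms by (auto simp: dstar_parts_def Suc_le_eq card_gt_0_iff)
  have x: "x \<noteq> u" "x \<noteq> v" "x \<notin> A" "x \<notin> B" using assms(3) by (auto simp: dstar_def)
  have w: "w \<noteq> u" "w \<noteq> v" "w \<notin> B" using assms(1,2) by (auto simp: dstar_parts_def)
  have parts: "dstar_parts 0 1 ?A ?B" using A by (rule dstar_parts_double_star)
  obtain g where g: "g 0 = u" "g 1 = v" "g ` ?A' = A - {w}" "g ` ?B = B" "inj_on g ({0, 1} \<union> ?A' \<union> ?B)"
    by (rule bij_dstar[of ?A' "A - {w}" ?B B 0 1 u v]) (use assms A in \<open>auto simp: dstar_parts_def\<close>)
  \<comment> \<open>The new vertex \<open>?w\<close> goes to the middle \<open>w\<close> of the long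
    leg, and the leaf \<open>2\<close>, whose edge is subdivided, to its end
    \<open>x\<close>.\<close>
  define h where "h = g(?w := w, 2 := x)"
  have h: "h 0 = u" "h 1 = v" "h ?w = w" "h 2 = x" using g A by (auto simp: h_def)
  have "h ` ?A' = g ` ?A'" by (rule image_cong) (auto simp: h_def)
  with g(3) have hA: "h ` ?A' = A - {w}" by (rule trans[rotated])
  have "h ` ?B = g ` ?B" by (rule image_cong) (use A in \<open>auto simp: h_def\<close>)
  with g(4) have hB: "h ` ?B = B" by (rule trans[rotated])
  have inj_h: "inj_on h ({0, 1} \<union> ?A' \<union> ?B)"
    by (rule inj_on_cong[THEN iffD2, OF _ g(5)]) (use A in \<open>auto simp: h_def\<close>)
  have img: "h ` ({0, 1} \<union> ?A' \<union> ?B) = {u, v} \<union> (A - {w}) \<union> B"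
    using h(1,2) hA hB by (simp only: image_Un image_insert image_empty)
  have add: "inj_on h (insert y S)" if "inj_on h S" "h y \<notin> h ` S" for y S
    using that unfolding inj_on_insert by blast
  have "inj_on h (insert ?w ({0, 1} \<union> ?A' \<union> ?B))"
    by (rule add[OF inj_h]) (simp only: img h(3), use w in simp)
  then have "inj_on h (insert 2 (insert ?w ({0, 1} \<union> ?A' \<union> ?B)))"
    by (rule add) (simp only: image_insert[of _ ?w] img h(3,4), use x assms(2) in auto)
  moreover have "verts (add_leaf (dstar 0 1 (insert ?w ?A') ?B) ?w 2) = insert 2 (insert ?w ({0, 1} \<union> ?A' \<union> ?B))"
    by (auto simp: dstar_def)
  ultimately have inj: "inj_on h (verts (add_leaf (dstar 0 1 (insert ?w ?A') ?B) ?w 2))" by simp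
  have "{0, 2} \<in> edges (double_star (card A) (card B))" "{0, 2} \<noteq> {0, 1 :: nat}"
    using A by (auto simp: double_star_eq dstar_def doubleton_eq_iff)
  then have "pendent_edge (double_star (card A) (card B)) {0, 2}"
    using double_star_pendent[OF A] by simp
  then have "subdivide_edge (double_star (card A) (card B)) {0, 2} ?w \<in> double_star1 (card A) (card B)"
    unfolding double_star1_def by (intro CollectI exI conjI) (rule refl)
  moreover have "subdivide_edge (double_star (card A) (card B)) {0, 2} ?w =
      add_leaf (dstar 0 1 (insert ?w ?A') ?B) ?w 2"
    unfolding double_star_eq using A by (intro subdivide_dstar parts) auto
  ultimately have H: "add_leaf (dstar 0 1 (insert ?w ?A') ?B) ?w 2 \<in> double_star1 (card A) (card B)" by simp
  have "graph_iso (map_graph h (add_leaf (dstar 0 1 (insert ?w ?A') ?B) ?w 2))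
      (add_leaf (dstar 0 1 (insert ?w ?A') ?B) ?w 2)"
    by (intro graph_iso_map inj) (use tight_double_star1[OF A H] in blast)
  moreover have "h ` insert ?w ?A' = A" using hA h(3) assms(2) by (simp add: insert_absorb)
  ultimately show thesis using that[OF H] unfolding map_add_leaf map_dstar h hB by simp
qed

theorem theorem4p1:
  fixes G :: "'a ugraph" and n :: nat
  assumes "simple_graph G" and "connected_graph G" and "card (verts G) = n" and "n \<ge> 2"
  shows "(pc12 G = n - 1 \<longleftrightarrow>
            graph_iso G (star_graph n) \<or>
            (\<exists>n1 n2. n1 \<ge> 1 \<and> n2 \<ge> 1 \<and> graph_iso G (double_star n1 n2))) \<and>
         (pc12 G = n - 2 \<longleftrightarrow>
            (\<exists>k\<in>{3, 4, 5}. graph_iso G (cycle_graph k)) \<or>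
            (\<exists>H\<in>set graph_list_L. graph_iso G H) \<or>
            (\<exists>n1 n2. n1 \<ge> 1 \<and> n2 \<ge> 1 \<and> (\<exists>H\<in>double_star1 n1 n2. graph_iso G H)))"
    (is "(_ \<longleftrightarrow> ?I) \<and> (_ \<longleftrightarrow> ?II)")
proof -
  have I: "pc12 G = n - 1" if ?I
    using that
  proof
    assume "graph_iso G (star_graph n)"
    moreover have "simple_graph (star_graph n)" "tight 1 (star_graph n)"
      using tree_simple[OF tree_star[of "{1..<n}" 0]] tight_star[of "{1..<n}" 0] assms(4)
      by (simp_all add: star_graph_eq)
    ultimately show ?thesis using graph_iso_tight[OF _ assms(1)] assms(3) by metis
  next
    assume "\<exists>n1 n2. n1 \<ge> 1 \<and> n2 \<ge> 1 \<and> graph_iso G (double_star n1 n2)"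
    then obtain n1 n2 where "n1 \<ge> 1" "n2 \<ge> 1" and iso: "graph_iso G (double_star n1 n2)" by blast
    then have parts: "dstar_parts (0 :: nat) 1 {2..<n1 + 2} {n1 + 2..<n1 + n2 + 2}"
      by (intro dstar_parts_double_star)
    have "simple_graph (double_star n1 n2)" "tight 1 (double_star n1 n2)"
      unfolding double_star_eq using tree_simple[OF tree_dstar[OF parts]] tight_dstar[OF parts] .
    with iso show ?thesis using graph_iso_tight[OF _ assms(1)] assms(3) by metis
  qed
  have II_iff: "?II \<longleftrightarrow> (\<exists>s\<in>set shapes. graph_iso G (coded s)) \<or>
      (\<exists>n1 n2. n1 \<ge> 1 \<and> n2 \<ge> 1 \<and> (\<exists>H\<in>double_star1 n1 n2. graph_iso G H))"
  proof -
    have "(\<exists>H\<in>coded ` set shapes. graph_iso G H) \<longleftrightarrow>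
        (\<exists>H\<in>cycle_graph ` {3, 4, 5} \<union> set graph_list_L. graph_iso G H)"
      unfolding coded_shapes ..
    then show ?thesis by blast
  qed
  have II: "pc12 G = n - 2" if ?II
  proof -
    from that obtain H :: "nat ugraph" where "graph_iso G H" "simple_graph H \<and> tight 2 H"
      unfolding II_iff
      using tight_shape shapes_saves simple_graph_coded tight_double_star1 by metis
    then show ?thesis using graph_iso_tight[OF _ assms(1)] assms(3) by metis
  qed
  \<comment> \<open>Exhaustive cases with mutually exclusive consequences turn the implications from
    \<open>P\<close> to \<open>a\<close> and from \<open>Q\<close> to \<open>b\<close> into
    equivalences.\<close>
  have trichotomy: "P \<or> Q \<or> R \<Longrightarrow> (P \<Longrightarrow> a) \<Longrightarrow> (Q \<Longrightarrow> b) \<Longrightarrow> (R \<Longrightarrow> \<not> a \<and> \<not> b) \<Longrightarrow> \<not> (a \<and> b) \<Longrightarrow>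
    (a \<longleftrightarrow> P) \<and> (b \<longleftrightarrow> Q)" for P Q R a b :: bool
    by blast
  have classification: "?I \<or> ?II \<or> saves 3 G"
  proof -
    have card: "card (verts G) \<ge> 2" using assms by simp
    obtain T where T: "tree T" "verts T = verts G" "edges T \<subseteq> edges G"
      using spanning_tree[OF assms(1,2)] .
    show ?thesis
    proof (cases "edges T = edges G")
      case True
      then have G: "tree G" using T by (metis ugraph.surjective unit.exhaust)
      from tree_classification[OF G] show ?thesis
      proof (elim disjE exE conjE)
        fix u A assume star: "G = star u A" "finite A" "u \<notin> A"
        then have "n = Suc (card A)" using assms(3) by (simp add: star_def)
        with star have "graph_iso G (star_graph n)" using star_iso[OF star(2,3)] by simp
        then show ?thesis by blast
      next
        fix u v A B assume G: "G = dstar u v A B" "dstar_parts u v A B"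
        from G(2) have "card A \<ge> 1" "card B \<ge> 1" by (auto simp: dstar_parts_def Suc_le_eq card_gt_0_iff)
        with dstar_iso[OF G(2)] G(1) show ?thesis by blast
      next
        fix u v A B w x
        assume G: "G = add_leaf (dstar u v A B) w x" and d: "dstar_parts u v A B" "w \<in> A"
          "x \<notin> verts (dstar u v A B)"
        from d(1) have "card A \<ge> 1" "card B \<ge> 1" by (auto simp: dstar_parts_def Suc_le_eq card_gt_0_iff)
        with dstar1_iso[OF d] G show ?thesis by metis
      qed blast
    next
      case False
      with T(3) have "edges T \<subset> edges G" by blast
      from cycle_or_long_path[OF assms(1,2) T(1,2) this] show ?thesis
      proof cases
        case (1 xs)
        have "(6, [(0, 1), (1, 2), (2, 3), (3, 4), (4, 5)]) \<in> set savers" by (simp add: savers_def)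
        then show ?thesis using saves_embedded[OF _ 1 _ assms(1,2) card] savers_saves by blast
      next
        case (2 xs s)
        from shape_or_saves[OF assms(1,2) card 2] show ?thesis
        proof (elim disjE bexE exE conjE)
          fix s xs assume s: "s \<in> set shapes" "embedded s xs G" "G = map_graph ((!) xs) (coded s)"
          have "graph_iso (map_graph ((!) xs) (coded s)) (coded s)"
            using graph_iso_map simple_graph_coded embedded_image(1)[OF s(2)] shapes_saves[OF s(1)]
            by blast
          with s have "\<exists>s\<in>set shapes. graph_iso G (coded s)" by metis
          then show ?thesis unfolding II_iff by blast
        qed blast
      qed
    qed
  qed
  show ?thesis
  proof (rule trichotomy[OF classification I II])
    show "pc12 G \<noteq> n - 1 \<and> pc12 G \<noteq> n - 2" if "saves 3 G"
      using pc12_le[OF that] assms(3) by linarith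
    \<comment> \<open>For \<open>n \<ge> 2\<close> the truncated differences \<open>n - 1\<close>
      and \<open>n - 2\<close> are different numbers.\<close>
    show "\<not> (pc12 G = n - 1 \<and> pc12 G = n - 2)" using assms(4) by linarith
  qed
qed

end
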